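(* Let $f,g,h\in C_0(\mathbb{R}^n)$ be non-negative functions, none of which is identically zero. Suppose that $f$ is compactly supported. Then $$M^{h}(f,g_-)=N^{h}(f,g).$$ Moreover, there exists a non-negative Borel measure $\rho$ on $\mathbb{R}^n$ with $\rho*g_-\le h$ everywhere on $\mathbb{R}^n$ such that $\int f\,d\rho=M^{h}(f,g_-)$.
   Context: $C_0(\mathbb{R}^n)$ is the space of continuous real-valued functions on $\mathbb{R}^n$ vanishing at infinity. For a function $u$ on $\mathbb{R}^n$, $u_-(x)=u(-x)$. For a non-negative Borel measure $\mu$ and a Borel function $g\ge 0$, $(\mu*g)(x)=\int g(x-t)\,d\mu(t)$. For Borel measurable $f,g,h:\mathbb{R}^n\to[0,\infty)$ define the $h$-covering number $$N^h(f,g)=\inf\Big\{\int h\,d\mu:\ \mu*g\ge f \text{ everywhere on }\mathbb{R}^n\Big\}$$ and the $h$-separation number $$M^h(f,g)=\sup\Big\{\int f\,d\rho:\ \rho*g\le h\text{ everywhere on }\mathbb{R}^n\Big\},$$ where the infimum and supremum are over all non-negative Borel measures on $\mathbb{R}^n$ (with $\inf\emptyset=+\infty$). *)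

theory Defs
  imports "HOL-Analysis.Analysis"
begin

(* On a Euclidean space the filter at_infinity is that of complements of compact sets. *)
definition C0 :: "('a::euclidean_space \<Rightarrow> real) set" where
  "C0 = {u. continuous_on UNIV u \<and> (u \<longlongrightarrow> 0) at_infinity}"

definition compactly_supported :: "('a::euclidean_space \<Rightarrow> real) \<Rightarrow> bool" where
  "compactly_supported u \<longleftrightarrow> compact (closure {x. u x \<noteq> 0})"

definition reflect :: "('a::euclidean_space \<Rightarrow> real) \<Rightarrow> 'a \<Rightarrow> real" where
  "reflect u = (\<lambda>x. u (- x))"

(* Arbitrary non-negative Borel measures: neither local finiteness nor sigma-finiteness
   is required.  The condition on sets also forces the space of the measure to be UNIV. *)
definition borel_measures :: "'a::euclidean_space measure set" where
  "borel_measures = {\<mu>. sets \<mu> = sets borel}"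

(* The functions below are meant to be Borel and non-negative; ennreal is then the inclusion
   of [0, \<infinity>) into [0, \<infinity>]. *)
definition conv :: "'a::euclidean_space measure \<Rightarrow> ('a \<Rightarrow> real) \<Rightarrow> 'a \<Rightarrow> ennreal" where
  "conv \<mu> g x = (\<integral>\<^sup>+ t. ennreal (g (x - t)) \<partial>\<mu>)"

definition covering_number ::
  "('a::euclidean_space \<Rightarrow> real) \<Rightarrow> ('a \<Rightarrow> real) \<Rightarrow> ('a \<Rightarrow> real) \<Rightarrow> ennreal" where
  "covering_number h f g =
     Inf {(\<integral>\<^sup>+ x. ennreal (h x) \<partial>\<mu>) | \<mu>.
            \<mu> \<in> borel_measures \<and> (\<forall>x. conv \<mu> g x \<ge> ennreal (f x))}"

definition separation_number ::
  "('a::euclidean_space \<Rightarrow> real) \<Rightarrow> ('a \<Rightarrow> real) \<Rightarrow> ('a \<Rightarrow> real) \<Rightarrow> ennreal" where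
  "separation_number h f g =
     Sup {(\<integral>\<^sup>+ x. ennreal (f x) \<partial>\<rho>) | \<rho>.
            \<rho> \<in> borel_measures \<and> (\<forall>x. conv \<rho> g x \<le> ennreal (h x))}"

end

theory Submission
  imports Defs "HOL-Probability.Helly_Selection"
begin

text \<open>
  Weak duality is Tonelli's theorem. For the converse put \<open>V = N\<^sup>h(f,g)\<close>. Restricting the packing measure to
  a fine finite net of the support of \<open>f\<close>, and the packing constraint \<open>\<le> h + \<epsilon>\<close> to a finite net of a large ball,
  gives a finite linear program. If no finitely supported \<open>\<rho>\<close> satisfies it with \<open>\<integral>f d\<rho> \<ge> V - \<epsilon>\<close>, then Farkas'
  lemma yields a finite measure \<open>\<mu>\<close> covering \<open>f\<close> on the net with \<open>\<integral>(h + \<epsilon>) d\<mu> < V - \<epsilon>\<close>. The \<open>\<epsilon>\<close> added to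
  \<open>h\<close> bounds the mass of \<open>\<mu>\<close> by \<open>\<bar>V\<bar> / \<epsilon>\<close>, so by uniform continuity adding a small fixed measure turns \<open>\<mu>\<close> into
  a genuine covering of cost below \<open>V\<close>, a contradiction. The resulting \<open>\<rho>\<close> live on a fixed compact set and have
  bounded mass, and a weak limit as \<open>\<epsilon> \<rightarrow> 0\<close> is the required maximiser. Weak compactness is reduced to Helly's
  theorem on the line by lifting measures along a space-filling curve.
\<close>

section \<open>Finite linear programming\<close>

text \<open>Bartl's induction: in the step, every functional is composed with the projection onto the kernel of the
  new one along a vector \<open>x0\<close> that witnesses the failure of the conclusion without the new constraint.\<close>

lemma farkas_finite:
  fixes a :: "'i \<Rightarrow> 'v \<Rightarrow> real" and c :: "'v \<Rightarrow> real"
  assumes "finite I" and V: "finite V"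
    and "\<And>x. (\<forall>i\<in>I. (\<Sum>v\<in>V. a i v * x v) \<le> 0) \<Longrightarrow> (\<Sum>v\<in>V. c v * x v) \<le> 0"
  shows "\<exists>l. (\<forall>i\<in>I. 0 \<le> l i) \<and> (\<forall>v\<in>V. c v = (\<Sum>i\<in>I. l i * a i v))"
  using assms(1,3)
proof (induction I arbitrary: a c rule: finite_induct)
  case empty
  \<comment> \<open>With no constraints \<open>x = c\<close> is admissible, and it makes the sum of
    squares nonpositive.\<close>
  have "(\<Sum>v\<in>V. c v * c v) = 0"
    using empty[of c] by (intro antisym sum_nonneg) auto
  then have "\<forall>v\<in>V. c v * c v = 0"
    using V by (subst (asm) sum_nonneg_eq_0_iff) auto
  then show ?case by auto
next
  case (insert j I)
  show ?case
  proof (cases "\<forall>x. (\<forall>i\<in>I. (\<Sum>v\<in>V. a i v * x v) \<le> 0) \<longrightarrow> (\<Sum>v\<in>V. c v * x v) \<le> 0")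
    case True
    then obtain l where l: "\<forall>i\<in>I. 0 \<le> l i" "\<forall>v\<in>V. c v = (\<Sum>i\<in>I. l i * a i v)"
      using insert.IH[of a c] by blast
    show ?thesis
      using insert.hyps l
      by (intro exI[of _ "l(j := 0)"]) (auto intro!: sum.cong)
  next
    case False
    then obtain y where y: "\<forall>i\<in>I. (\<Sum>v\<in>V. a i v * y v) \<le> 0" "(\<Sum>v\<in>V. c v * y v) > 0"
      by (auto simp: not_le)
    define p where "p = (\<Sum>v\<in>V. a j v * y v)"
    \<comment> \<open>Otherwise \<open>y\<close> would satisfy the new constraint as well and still
      give \<open>c\<close> a positive value.\<close>
    have p: "p > 0"
      using insert.prems[of y] y unfolding p_def by (force simp: not_le[symmetric])
    define x0 where "x0 v = y v / p" for v
    have x0_dot: "(\<Sum>v\<in>V. w v * x0 v) = (\<Sum>v\<in>V. w v * y v) / p" for w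
      by (simp add: x0_def sum_divide_distrib)
    have x0: "\<forall>i\<in>I. (\<Sum>v\<in>V. a i v * x0 v) \<le> 0" "(\<Sum>v\<in>V. c v * x0 v) > 0"
      "(\<Sum>v\<in>V. a j v * x0 v) = 1"
      unfolding x0_dot using y p by (auto simp: p_def[symmetric] divide_nonpos_pos)
    define a' where "a' i v = a i v - (\<Sum>w\<in>V. a i w * x0 w) * a j v" for i v
    define c' where "c' v = c v - (\<Sum>w\<in>V. c w * x0 w) * a j v" for v
    have "(\<Sum>v\<in>V. c' v * x v) \<le> 0" if x: "\<forall>i\<in>I. (\<Sum>v\<in>V. a' i v * x v) \<le> 0" for x
    proof -
      define s where "s = (\<Sum>v\<in>V. a j v * x v)"
      define z where "z v = x v - s * x0 v" for v
      have z_dot: "(\<Sum>v\<in>V. w v * z v) = (\<Sum>v\<in>V. w v * x v) - s * (\<Sum>v\<in>V. w v * x0 v)" for w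
        by (simp add: z_def algebra_simps sum_subtractf sum_distrib_left)
      have "(\<Sum>v\<in>V. a j v * z v) = 0"
        unfolding z_dot x0(3) s_def by simp
      moreover have "(\<Sum>v\<in>V. a i v * z v) = (\<Sum>v\<in>V. a' i v * x v)" for i
        unfolding z_dot unfolding a'_def s_def
        by (simp add: algebra_simps sum_subtractf sum_distrib_left sum_distrib_right)
      moreover have "(\<Sum>v\<in>V. c v * z v) = (\<Sum>v\<in>V. c' v * x v)"
        unfolding z_dot unfolding c'_def s_def
        by (simp add: algebra_simps sum_subtractf sum_distrib_left sum_distrib_right)
      ultimately show ?thesis
        using insert.prems[of z] x by simp
    qed
    then obtain l where l: "\<forall>i\<in>I. 0 \<le> l i" "\<forall>v\<in>V. c' v = (\<Sum>i\<in>I. l i * a' i v)"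
      using insert.IH[of a' c'] by blast
    \<comment> \<open>Expanding \<open>a'\<close> and \<open>c'\<close> in the identity for
      \<open>c'\<close> leaves exactly this coefficient of \<open>a j\<close>. It is nonnegative
      because \<open>x0\<close> makes \<open>c\<close> positive and all old constraints
      nonpositive.\<close>
    define q where "q = (\<Sum>w\<in>V. c w * x0 w) - (\<Sum>i\<in>I. l i * (\<Sum>w\<in>V. a i w * x0 w))"
    have "(\<Sum>i\<in>I. l i * (\<Sum>w\<in>V. a i w * x0 w)) \<le> 0"
      using l x0 by (intro sum_nonpos) (auto simp: mult_nonneg_nonpos)
    then have "q \<ge> 0" unfolding q_def using x0 by simp
    moreover have "c v = q * a j v + (\<Sum>i\<in>I. l i * a i v)" if "v \<in> V" for v
    proof -
      have "c v = (\<Sum>i\<in>I. l i * a' i v) + (\<Sum>w\<in>V. c w * x0 w) * a j v"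
        using l(2) that unfolding c'_def by (metis diff_add_cancel)
      also have "(\<Sum>i\<in>I. l i * a' i v)
          = (\<Sum>i\<in>I. l i * a i v) - (\<Sum>i\<in>I. l i * (\<Sum>w\<in>V. a i w * x0 w)) * a j v"
        unfolding sum_distrib_right[of "\<lambda>i. l i * (\<Sum>w\<in>V. a i w * x0 w)"] sum_subtractf[symmetric]
        by (simp add: a'_def right_diff_distrib mult.assoc)
      finally show ?thesis unfolding q_def by (simp add: algebra_simps)
    qed
    ultimately show ?thesis
      using insert.hyps l(1)
      by (intro exI[of _ "l(j := q)"]) (auto intro!: sum.cong)
  qed
qed

text \<open>Farkas' lemma applied to the homogenised system, whose extra variable is indexed by \<open>None\<close>.\<close>

lemma finite_lp_alternative:
  fixes A :: "'x \<Rightarrow> 't \<Rightarrow> real" and b :: "'t \<Rightarrow> real" and c :: "'x \<Rightarrow> real"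
  assumes X: "finite X" and T: "finite T"
  obtains
    (primal) r where "\<forall>x\<in>X. 0 \<le> r x" "\<forall>t\<in>T. (\<Sum>x\<in>X. A x t * r x) \<le> b t" "d \<le> (\<Sum>x\<in>X. c x * r x)"
  | (dual) m l where "\<forall>t\<in>T. 0 \<le> m t" "0 \<le> l" "\<forall>x\<in>X. l * c x \<le> (\<Sum>t\<in>T. A x t * m t)"
      "(\<Sum>t\<in>T. b t * m t) < l * d"
proof (cases "\<exists>r. (\<forall>x\<in>X. 0 \<le> r x) \<and> (\<forall>t\<in>T. (\<Sum>x\<in>X. A x t * r x) \<le> b t) \<and> d \<le> (\<Sum>x\<in>X. c x * r x)")
  case True
  then show ?thesis using primal by blast
next
  case False
  \<comment> \<open>The variable \<open>None\<close> is the scale of homogenisation. Row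
    \<open>Inl x\<close> encodes nonnegativity at \<open>x\<close>, row \<open>Inr (Some t)\<close>
    the constraint at \<open>t\<close>, and row \<open>Inr None\<close> the demand that the
    objective reach \<open>d\<close>.\<close>
  define a :: "'x + 't option \<Rightarrow> 'x option \<Rightarrow> real" where
    "a i v = (case i of Inl x \<Rightarrow> if v = Some x then -1 else 0
      | Inr None \<Rightarrow> (case v of None \<Rightarrow> d | Some x \<Rightarrow> - c x)
      | Inr (Some t) \<Rightarrow> (case v of None \<Rightarrow> - b t | Some x \<Rightarrow> A x t))" for i v
  let ?V = "insert None (Some ` X)" and ?I = "X <+> insert None (Some ` T)"
  let ?c = "\<lambda>v::'x option. if v = None then 1 else (0::real)"
  have sumV: "(\<Sum>v\<in>?V. w v) = w None + (\<Sum>x\<in>X. w (Some x))" for w :: "'x option \<Rightarrow> real"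
    using X by (subst sum.insert) (auto simp: sum.reindex)
  have sumI: "(\<Sum>i\<in>?I. w i) = (\<Sum>x\<in>X. w (Inl x)) + (w (Inr None) + (\<Sum>t\<in>T. w (Inr (Some t))))"
    for w :: "'x + 't option \<Rightarrow> real"
    using X T by (subst sum.Plus) (auto simp: sum.reindex)
  \<comment> \<open>If the scale were positive, dividing by it would produce a primal
    solution.\<close>
  have "(\<Sum>v\<in>?V. ?c v * z v) \<le> 0" if z: "\<forall>i\<in>?I. (\<Sum>v\<in>?V. a i v * z v) \<le> 0" for z
  proof (rule ccontr)
    assume "\<not> ?thesis"
    then have s: "z None > 0" by (simp add: sumV)
    have "- z (Some x) \<le> 0" if "x \<in> X" for x
    proof -
      have "(\<Sum>v\<in>?V. a (Inl x) v * z v) = (\<Sum>y\<in>X. if y = x then - z (Some x) else 0)"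
        unfolding sumV by (auto simp: a_def intro!: sum.cong)
      moreover have "(\<Sum>v\<in>?V. a (Inl x) v * z v) \<le> 0" using z that by blast
      ultimately show ?thesis using that X by simp
    qed
    moreover have "(\<Sum>x\<in>X. A x t * z (Some x)) \<le> b t * z None" if "t \<in> T" for t
    proof -
      have "(\<Sum>v\<in>?V. a (Inr (Some t)) v * z v) \<le> 0" using z that by blast
      then show ?thesis unfolding sumV by (simp add: a_def)
    qed
    moreover have "d * z None \<le> (\<Sum>x\<in>X. c x * z (Some x))"
    proof -
      have "(\<Sum>v\<in>?V. a (Inr None) v * z v) \<le> 0" using z by blast
      then show ?thesis unfolding sumV by (simp add: a_def sum_negf)
    qed
    ultimately show False
      using False s
      by (elim notE, intro exI[of _ "\<lambda>x. z (Some x) / z None"])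
        (auto simp: sum_divide_distrib[symmetric] pos_divide_le_eq pos_le_divide_eq)
  qed
  then obtain l where l: "\<forall>i\<in>?I. 0 \<le> l i" "\<forall>v\<in>?V. ?c v = (\<Sum>i\<in>?I. l i * a i v)"
    using farkas_finite[of ?I ?V a ?c] X T by auto
  show ?thesis
  \<comment> \<open>Column \<open>Some x\<close> of the Farkas identity gives the dual inequality
    with slack \<open>l (Inl x)\<close>. Column \<open>None\<close> has the value 1 on the left,
    which makes the last inequality strict. The multiplier of the objective row may still be zero
    here.\<close>
  proof (rule dual[of "\<lambda>t. l (Inr (Some t))" "l (Inr None)"])
    show "\<forall>t\<in>T. 0 \<le> l (Inr (Some t))" "0 \<le> l (Inr None)" using l(1) by auto
    show "\<forall>x\<in>X. l (Inr None) * c x \<le> (\<Sum>t\<in>T. A x t * l (Inr (Some t)))"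
    proof
      fix x assume x: "x \<in> X"
      have "0 = (\<Sum>i\<in>?I. l i * a i (Some x))" using l(2) x by force
      also have "\<dots> = (\<Sum>y\<in>X. if y = x then - l (Inl x) else 0) - l (Inr None) * c x
          + (\<Sum>t\<in>T. A x t * l (Inr (Some t)))"
        unfolding sumI by (auto simp: a_def mult.commute intro!: sum.cong)
      finally show "l (Inr None) * c x \<le> (\<Sum>t\<in>T. A x t * l (Inr (Some t)))"
        using x X l(1)[rule_format, OF InlI[OF x]] by simp
    qed
    have "1 = (\<Sum>i\<in>?I. l i * a i None)" using l(2) by auto
    also have "\<dots> = l (Inr None) * d - (\<Sum>t\<in>T. b t * l (Inr (Some t)))"
      unfolding sumI by (simp add: a_def sum_negf mult.commute)
    finally show "(\<Sum>t\<in>T. b t * l (Inr (Some t))) < l (Inr None) * d" by simp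
  qed
qed

section \<open>Approximately optimal finitely supported measures\<close>

lemma finite_net_of_compact:
  fixes K :: "'a::metric_space set"
  assumes "compact K" "0 < d"
  obtains N where "finite N" "N \<subseteq> K" "\<forall>x\<in>K. \<exists>y\<in>N. dist x y < d"
proof -
  obtain N where "N \<subseteq> K" "finite N" "K \<subseteq> (\<Union>y\<in>N. ball y d)"
    using assms by (elim compactE_image[of K K "\<lambda>y. ball y d"]) auto
  then show ?thesis using that[of N] by (fastforce simp: dist_commute)
qed

lemma continuous_on_compact_uniform:
  fixes u :: "'a::metric_space \<Rightarrow> real"
  assumes "continuous_on UNIV u" "compact S" "0 < e"
  obtains d where "0 < d" "\<forall>x\<in>S. \<forall>y\<in>S. dist x y < d \<longrightarrow> \<bar>u x - u y\<bar> < e"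
proof -
  have "uniformly_continuous_on S u"
    using assms by (meson compact_uniformly_continuous continuous_on_subset subset_UNIV)
  then show ?thesis
    using assms(3) that unfolding uniformly_continuous_on_def dist_real_def by metis
qed

text \<open>By continuity \<open>g\<close> exceeds half of \<open>g x0\<close> on a ball about
  \<open>x0\<close>, so a net of \<open>K\<close> of that radius, shifted by \<open>x0\<close>,
  suffices. The translates serve to bound masses, to repair dual solutions and to show that the
  covering number is finite.\<close>

lemma finite_translates_cover:
  fixes g :: "'a::real_normed_vector \<Rightarrow> real"
  assumes g: "continuous_on UNIV g" and K: "compact K" and pos: "g x0 > 0"
  obtains T c where "finite T" "0 < c" "\<forall>x\<in>K. \<exists>t\<in>T. c \<le> g (x - t)"
proof -
  have "isCont g x0" using g by (simp add: continuous_on_eq_continuous_at)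
  then obtain d where d: "d > 0" "\<And>y. dist y x0 < d \<Longrightarrow> dist (g y) (g x0) < g x0 / 2"
    unfolding continuous_at_eps_delta using half_gt_zero[OF pos] by blast
  obtain N where N: "finite N" "N \<subseteq> K" "\<forall>x\<in>K. \<exists>y\<in>N. dist x y < d"
    by (rule finite_net_of_compact[OF K d(1)])
  show ?thesis
  proof (rule that[of "(\<lambda>y. y - x0) ` N" "g x0 / 2"])
    show "\<forall>x\<in>K. \<exists>t\<in>(\<lambda>y. y - x0) ` N. g x0 / 2 \<le> g (x - t)"
    proof
      fix x assume "x \<in> K"
      then obtain y where y: "y \<in> N" "dist x y < d" using N by blast
      have "dist (x - (y - x0)) x0 < d" using y(2) by (simp add: dist_norm)
      then have "dist (g (x - (y - x0))) (g x0) < g x0 / 2" by (rule d)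
      then have "g x0 / 2 \<le> g (x - (y - x0))" unfolding dist_real_def by linarith
      then show "\<exists>t\<in>(\<lambda>y. y - x0) ` N. g x0 / 2 \<le> g (x - t)" using y by blast
    qed
  qed (use N pos in auto)
qed

text \<open>Moving from \<open>x\<close> to a net point \<open>y\<close> costs half of
  \<open>\<eta>\<close> in \<open>f\<close> and, since \<open>m\<close> has mass at most
  \<open>M\<close>, another half in the sum.\<close>

lemma dual_repair:
  fixes f g :: "'a::ab_group_add \<Rightarrow> real"
  assumes T: "finite T"
    and net: "\<exists>y\<in>X. \<bar>f x - f y\<bar> \<le> \<eta> / 2 \<and> (\<forall>t\<in>T. \<bar>g (x - t) - g (y - t)\<bar> * M \<le> \<eta> / 2)"
    and m: "\<forall>t\<in>T. 0 \<le> m t" "(\<Sum>t\<in>T. m t) \<le> M"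
    and dual: "\<forall>x\<in>X. f x \<le> (\<Sum>t\<in>T. g (x - t) * m t)"
  shows "f x - \<eta> \<le> (\<Sum>t\<in>T. g (x - t) * m t)"
proof -
  obtain y where y: "y \<in> X" "\<bar>f x - f y\<bar> \<le> \<eta> / 2" "\<forall>t\<in>T. \<bar>g (x - t) - g (y - t)\<bar> * M \<le> \<eta> / 2"
    using net by blast
  have sum_m: "0 \<le> (\<Sum>t\<in>T. m t)" using m(1) by (intro sum_nonneg) auto
  have \<eta>: "0 \<le> \<eta>" using y(2) by linarith
  have "(\<Sum>t\<in>T. g (y - t) * m t) - (\<Sum>t\<in>T. g (x - t) * m t)
      = (\<Sum>t\<in>T. (g (y - t) - g (x - t)) * m t)"
    by (simp add: sum_subtractf left_diff_distrib)
  also have "\<dots> \<le> \<eta> / 2"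
  \<comment> \<open>Division by \<open>M\<close> requires \<open>M > 0\<close>; in the other case
    all weights vanish.\<close>
  proof (cases "M \<le> 0")
    case True
    then have "(\<Sum>t\<in>T. m t) = 0" using m(2) sum_m by linarith
    then have "\<forall>t\<in>T. m t = 0" using m(1) T by (subst (asm) sum_nonneg_eq_0_iff) auto
    then show ?thesis using \<eta> by simp
  next
    case False
    then have M: "M > 0" by simp
    have "(\<Sum>t\<in>T. (g (y - t) - g (x - t)) * m t) \<le> (\<Sum>t\<in>T. (\<eta> / 2 / M) * m t)"
    proof (intro sum_mono mult_right_mono)
      fix t assume t: "t \<in> T"
      have "\<bar>g (x - t) - g (y - t)\<bar> \<le> \<eta> / 2 / M"
        using y(3)[rule_format, OF t] M by (subst pos_le_divide_eq) auto
      then show "g (y - t) - g (x - t) \<le> \<eta> / 2 / M" by linarith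
    qed (use m in auto)
    also have "\<dots> = (\<eta> / 2 / M) * (\<Sum>t\<in>T. m t)" by (simp add: sum_distrib_left)
    also have "\<dots> \<le> (\<eta> / 2 / M) * M"
      using m \<eta> M by (intro mult_left_mono) auto
    finally show ?thesis using M by simp
  qed
  finally have "(\<Sum>t\<in>T. g (y - t) * m t) - (\<Sum>t\<in>T. g (x - t) * m t) \<le> \<eta> / 2" .
  moreover have "f y \<le> (\<Sum>t\<in>T. g (y - t) * m t)" using dual y(1) by blast
  ultimately show ?thesis using y(2) by linarith
qed

text \<open>Linear programming duality on finite nets: a dual solution, once repaired, would be a
  finitely supported covering cheaper than \<open>V\<close>. The mass bound \<open>R\<close> is
  independent of \<open>e\<close> and all atoms lie in \<open>K\<close>, which is what the passage
  to a weak limit requires.\<close>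

lemma approximate_separation:
  fixes f g h :: "'a::euclidean_space \<Rightarrow> real"
  assumes f: "continuous_on UNIV f" and g: "g \<in> C0" and h: "continuous_on UNIV h"
    and g0: "\<And>x. 0 \<le> g x" and h0: "\<And>x. 0 \<le> h x" and gx0: "0 < g x0"
    and K: "compact K" and fK: "\<And>x. x \<notin> K \<Longrightarrow> f x = 0"
    and V: "\<And>T m. finite T \<Longrightarrow> \<forall>t\<in>T. 0 \<le> m t \<Longrightarrow> \<forall>x. f x \<le> (\<Sum>t\<in>T. g (x - t) * m t)
      \<Longrightarrow> V \<le> (\<Sum>t\<in>T. h t * m t)"
  obtains R where "0 \<le> R" "\<forall>e>0. \<exists>X r. finite X \<and> X \<subseteq> K \<and> (\<forall>x\<in>X. 0 \<le> r x) \<and> (\<Sum>x\<in>X. r x) \<le> R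
     \<and> (\<forall>t. (\<Sum>x\<in>X. g (x - t) * r x) \<le> h t + e) \<and> V - e \<le> (\<Sum>x\<in>X. f x * r x)"
proof -
  have gc: "continuous_on UNIV g" and glim: "(g \<longlongrightarrow> 0) at_infinity"
    using g by (auto simp: C0_def)
  obtain T0 c where T0: "finite T0" "0 < c" "\<forall>x\<in>K. \<exists>t\<in>T0. c \<le> g (x - t)"
    by (rule finite_translates_cover[OF gc K gx0])
  have T0_cover: "c \<le> (\<Sum>t\<in>T0. g (x - t))" if "x \<in> K" for x
  proof -
    obtain t where "t \<in> T0" "c \<le> g (x - t)" using T0(3) \<open>x \<in> K\<close> by blast
    moreover have "g (x - t) \<le> (\<Sum>t\<in>T0. g (x - t))"
      using \<open>t \<in> T0\<close> T0(1) g0 by (intro member_le_sum) auto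
    ultimately show ?thesis by linarith
  qed
  \<comment> \<open>This comes from adding the packing constraints at the points of
    \<open>T0\<close>: on \<open>K\<close> the translates sum to at least \<open>c\<close>, and each
    right-hand side is at most \<open>h t + 1\<close>.\<close>
  define R where "R = (\<Sum>t\<in>T0. h t + 1) / c"
  have R: "0 \<le> R" unfolding R_def using T0(2) h0 by (auto intro!: divide_nonneg_pos sum_nonneg add_nonneg_nonneg)
  obtain BK where BK: "BK > 0" "\<And>x. x \<in> K \<Longrightarrow> norm x \<le> BK"
    using compact_imp_bounded[OF K] by (auto simp: bounded_pos)
  \<comment> \<open>One \<open>e\<close> is the relaxation in the linear program; the other two pay
    for moving \<open>t\<close> to a net point, in \<open>g\<close> and in \<open>h\<close>. The
    restriction \<open>e \<le> 1\<close> keeps \<open>R\<close> independent of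
    \<open>e\<close>.\<close>
  have step: "\<exists>X r. finite X \<and> X \<subseteq> K \<and> (\<forall>x\<in>X. 0 \<le> r x) \<and> (\<Sum>x\<in>X. r x) \<le> R
     \<and> (\<forall>t. (\<Sum>x\<in>X. g (x - t) * r x) \<le> h t + 3 * e) \<and> V - 3 * e \<le> (\<Sum>x\<in>X. f x * r x)"
    if e: "0 < e" "e \<le> 1" for e
  proof -
    have eR: "0 < e / (R + 1)" using e R by simp
    obtain B where B: "\<And>y. B \<le> norm y \<Longrightarrow> g y < e / (R + 1)"
      using tendstoD[OF glim eR] g0 by (auto simp: eventually_at_infinity)
    \<comment> \<open>If \<open>norm t > L\<close>, then every point of \<open>K\<close> is at
      distance at least \<open>B\<close> from \<open>t\<close>, so \<open>g (x - t)\<close> is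
      negligible and only \<open>cball 0 L\<close> has to be discretised. The maximum places
      \<open>T0\<close> inside this ball.\<close>
    define L where "L = BK + max B (Max (insert 0 (norm ` T0)))"
    have L0: "norm t \<le> L" if "t \<in> T0" for t
    proof -
      have "norm t \<le> Max (insert 0 (norm ` T0))" using that T0(1) by (intro Max_ge) auto
      then show ?thesis using BK(1) unfolding L_def by linarith
    qed
    have far: "g (x - t) < e / (R + 1)" if "x \<in> K" "L < norm t" for x t
    proof (rule B)
      have "B \<le> L - BK" by (simp add: L_def)
      then show "B \<le> norm (x - t)"
        using BK(2)[OF that(1)] that(2) norm_triangle_sub[of t x] by (simp add: norm_minus_commute)
    qed
    have near: "x - t \<in> cball 0 (L + BK)" if "x \<in> K" "norm t \<le> L" for x t
      using BK(2)[OF that(1)] that(2) norm_triangle_ineq4[of x t] by simp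
    obtain d1 where d1: "0 < d1" "\<forall>x\<in>cball 0 (L + BK). \<forall>y\<in>cball 0 (L + BK).
        dist x y < d1 \<longrightarrow> \<bar>g x - g y\<bar> < e / (R + 1)"
      by (rule continuous_on_compact_uniform[OF gc compact_cball eR])
    obtain d2 where d2: "0 < d2" "\<forall>x\<in>cball 0 L. \<forall>y\<in>cball 0 L. dist x y < d2 \<longrightarrow> \<bar>h x - h y\<bar> < e"
      by (rule continuous_on_compact_uniform[OF h compact_cball e(1)])
    have "0 < min d1 d2" using d1(1) d2(1) by simp
    then obtain T1 :: "'a set" where T1: "finite T1" "T1 \<subseteq> cball 0 L" "\<forall>x\<in>cball 0 L. \<exists>y\<in>T1. dist x y < min d1 d2"
      by (rule finite_net_of_compact[OF compact_cball[of 0 L]])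
    \<comment> \<open>Including \<open>T0\<close> imposes the constraints that give the mass bound,
      and lets the repaired dual measure live on \<open>T\<close>.\<close>
    define T where "T = T0 \<union> T1"
    have T: "finite T" "T0 \<subseteq> T" "\<And>t. t \<in> T \<Longrightarrow> norm t \<le> L"
      using T0(1) T1 L0 by (auto simp: T_def)
    \<comment> \<open>\<open>C\<close> is the cost of raising the covering by one unit on all of
      \<open>K\<close>; \<open>\<eta>\<close> is chosen so that raising it by \<open>\<eta>\<close>
      costs at most \<open>e\<close>.\<close>
    define C where "C = (\<Sum>t\<in>T0. h t) / c"
    have C: "0 \<le> C" using T0(2) h0 by (simp add: C_def sum_nonneg)
    define \<eta> where "\<eta> = e / (C + 1)"
    have \<eta>: "0 < \<eta>" "\<eta> * C \<le> e" using e C by (auto simp: \<eta>_def field_simps)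
    \<comment> \<open>A priori bound on the dual mass: the relaxation \<open>e\<close> charges
      \<open>e\<close> per unit of mass, while the total cost stays below
      \<open>V - e\<close>.\<close>
    define M where "M = \<bar>V\<bar> / e"
    have M: "0 \<le> M" using e by (simp add: M_def)
    have \<eta>M: "0 < \<eta> / (2 * (M + 1))" using \<eta> M by simp
    obtain d3 where d3: "0 < d3" "\<forall>x\<in>cball 0 (L + BK). \<forall>y\<in>cball 0 (L + BK).
        dist x y < d3 \<longrightarrow> \<bar>g x - g y\<bar> < \<eta> / (2 * (M + 1))"
      by (rule continuous_on_compact_uniform[OF gc compact_cball \<eta>M])
    obtain d4 where d4: "0 < d4" "\<forall>x\<in>K. \<forall>y\<in>K. dist x y < d4 \<longrightarrow> \<bar>f x - f y\<bar> < \<eta> / 2"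
      by (rule continuous_on_compact_uniform[OF f K half_gt_zero[OF \<eta>(1)]])
    have "0 < min d3 d4" using d3(1) d4(1) by simp
    then obtain X where X: "finite X" "X \<subseteq> K" "\<forall>x\<in>K. \<exists>y\<in>X. dist x y < min d3 d4"
      by (rule finite_net_of_compact[OF K])
    have net: "\<exists>y\<in>X. \<bar>f x - f y\<bar> \<le> \<eta> / 2 \<and> (\<forall>t\<in>T. \<bar>g (x - t) - g (y - t)\<bar> * M \<le> \<eta> / 2)"
      if x: "x \<in> K" for x
    proof -
      obtain y where y: "y \<in> X" "dist x y < d3" "dist x y < d4" using X(3) x by auto
      have yK: "y \<in> K" using y X by auto
      have "\<bar>g (x - t) - g (y - t)\<bar> * M \<le> \<eta> / 2" if t: "t \<in> T" for t
      proof -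
        have "dist (x - t) (y - t) < d3" using y(2) by (simp add: dist_norm)
        then have "\<bar>g (x - t) - g (y - t)\<bar> \<le> \<eta> / (2 * (M + 1))"
          using d3(2)[rule_format, OF near[OF x T(3)[OF t]] near[OF yK T(3)[OF t]]] by simp
        then have "\<bar>g (x - t) - g (y - t)\<bar> * M \<le> \<eta> / (2 * (M + 1)) * (M + 1)"
          using M \<eta>M by (intro mult_mono) auto
        also have "\<dots> = \<eta> / 2" using M by (simp add: field_simps)
        finally show ?thesis .
      qed
      moreover have "\<bar>f x - f y\<bar> \<le> \<eta> / 2"
        using d4(2)[rule_format, OF x yK y(3)] by simp
      ultimately show ?thesis using y(1) by blast
    qed
    have "\<exists>r. (\<forall>x\<in>X. 0 \<le> r x) \<and> (\<forall>t\<in>T. (\<Sum>x\<in>X. g (x - t) * r x) \<le> h t + e)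
        \<and> V - e \<le> (\<Sum>x\<in>X. f x * r x)"
    proof (rule finite_lp_alternative[OF X(1) T(1), of "\<lambda>x t. g (x - t)" "\<lambda>t. h t + e" "V - e" f])
      fix m l
      assume m: "\<forall>t\<in>T. 0 \<le> m t" "0 \<le> l" "\<forall>x\<in>X. l * f x \<le> (\<Sum>t\<in>T. g (x - t) * m t)"
        "(\<Sum>t\<in>T. (h t + e) * m t) < l * (V - e)"
      \<comment> \<open>Nonnegativity of the right-hand sides \<open>h t + e\<close> excludes
        \<open>l = 0\<close>, so the dual solution can be normalised to
        \<open>l = 1\<close>.\<close>
      have "0 \<le> (\<Sum>t\<in>T. (h t + e) * m t)" using m(1) h0 e by (auto intro!: sum_nonneg)
      then have l: "l > 0" using m(2,4) by (cases "l = 0") auto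
      define m' where "m' t = m t / l" for t
      have m'0: "\<forall>t\<in>T. 0 \<le> m' t" using m(1) l by (auto simp: m'_def)
      have m'd: "\<forall>x\<in>X. f x \<le> (\<Sum>t\<in>T. g (x - t) * m' t)"
        using m(3) l by (auto simp: m'_def sum_divide_distrib[symmetric] pos_le_divide_eq mult.commute)
      have m'V: "(\<Sum>t\<in>T. (h t + e) * m' t) < V - e"
        using m(4) l by (auto simp: m'_def sum_divide_distrib[symmetric] pos_divide_less_eq mult.commute)
      have split: "(\<Sum>t\<in>T. (h t + e) * m' t) = (\<Sum>t\<in>T. h t * m' t) + e * (\<Sum>t\<in>T. m' t)"
        by (simp add: algebra_simps sum.distrib sum_distrib_left)
      have hm: "0 \<le> (\<Sum>t\<in>T. h t * m' t)" using m'0 h0 by (auto intro!: sum_nonneg)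
      have em: "0 \<le> e * (\<Sum>t\<in>T. m' t)" using m'0 e by (auto intro!: sum_nonneg mult_nonneg_nonneg)
      have "e * (\<Sum>t\<in>T. m' t) \<le> \<bar>V\<bar>" using m'V split hm e by linarith
      then have m'M: "(\<Sum>t\<in>T. m' t) \<le> M" using e unfolding M_def by (simp add: pos_le_divide_eq mult.commute)
      \<comment> \<open>The extra weight on \<open>T0\<close> lifts the sum by at least
        \<open>\<eta>\<close> on \<open>K\<close>, which cancels the defect left by
        \<open>dual_repair\<close>.\<close>
      define w where "w t = m' t + (if t \<in> T0 then \<eta> / c else 0)" for t
      have w0: "\<forall>t\<in>T. 0 \<le> w t" using m'0 \<eta> T0(2) by (auto simp: w_def)
      have wsum: "(\<Sum>t\<in>T. u t * w t) = (\<Sum>t\<in>T. u t * m' t) + \<eta> / c * (\<Sum>t\<in>T0. u t)" for u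
      proof -
        have "(\<Sum>t\<in>T. u t * w t) = (\<Sum>t\<in>T. u t * m' t) + (\<Sum>t\<in>T. if t \<in> T0 then \<eta> / c * u t else 0)"
          unfolding sum.distrib[symmetric] by (intro sum.cong) (auto simp: w_def algebra_simps)
        also have "(\<Sum>t\<in>T. if t \<in> T0 then \<eta> / c * u t else 0) = (\<Sum>t\<in>T0. \<eta> / c * u t)"
          using T(1,2) by (simp add: sum.inter_restrict[symmetric] Int_absorb1)
        finally show ?thesis by (simp add: sum_distrib_left)
      qed
      have "f x \<le> (\<Sum>t\<in>T. g (x - t) * w t)" for x
      proof (cases "x \<in> K")
        case True
        have "f x - \<eta> \<le> (\<Sum>t\<in>T. g (x - t) * m' t)"
          using dual_repair[OF T(1) net[OF True] m'0 m'M m'd] .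
        moreover have "\<eta> / c * c \<le> \<eta> / c * (\<Sum>t\<in>T0. g (x - t))"
          using T0_cover[OF True] \<eta> T0(2) by (intro mult_left_mono) auto
        ultimately show ?thesis unfolding wsum using T0(2) by simp
      next
        case False
        then show ?thesis using fK w0 g0 by (auto intro!: sum_nonneg)
      qed
      \<comment> \<open>Contradiction: the cost of \<open>m'\<close> under \<open>h\<close> is below
        \<open>V - e\<close>, and the repair adds at most \<open>e\<close>.\<close>
      then have "V \<le> (\<Sum>t\<in>T. h t * w t)" using V[OF T(1) w0] by blast
      also have "\<dots> = (\<Sum>t\<in>T. h t * m' t) + \<eta> * C" unfolding wsum by (simp add: C_def)
      finally show ?thesis using \<eta>(2) m'V split em by linarith
    qed blast
    then obtain r where r: "\<forall>x\<in>X. 0 \<le> r x" "\<forall>t\<in>T. (\<Sum>x\<in>X. g (x - t) * r x) \<le> h t + e"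
       "V - e \<le> (\<Sum>x\<in>X. f x * r x)" by blast
    have rR: "(\<Sum>x\<in>X. r x) \<le> R"
    proof -
      have "c * (\<Sum>x\<in>X. r x) = (\<Sum>x\<in>X. c * r x)" by (simp add: sum_distrib_left)
      also have "\<dots> \<le> (\<Sum>x\<in>X. (\<Sum>t\<in>T0. g (x - t)) * r x)"
        using T0_cover X(2) r(1) by (intro sum_mono mult_right_mono) auto
      also have "\<dots> = (\<Sum>t\<in>T0. \<Sum>x\<in>X. g (x - t) * r x)"
        unfolding sum_distrib_right by (rule sum.swap)
      also have "\<dots> \<le> (\<Sum>t\<in>T0. h t + 1)"
      proof (rule sum_mono)
        fix t assume "t \<in> T0"
        then have "(\<Sum>x\<in>X. g (x - t) * r x) \<le> h t + e" using r(2) T(2) by blast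
        then show "(\<Sum>x\<in>X. g (x - t) * r x) \<le> h t + 1" using e(2) by linarith
      qed
      finally show ?thesis using T0(2) by (simp add: R_def pos_le_divide_eq mult.commute)
    qed
    \<comment> \<open>The mass bound turns a pointwise estimate into one for the sum, both for the
      error of moving \<open>t\<close> to the net and for distant \<open>t\<close>.\<close>
    have small: "(\<Sum>x\<in>X. u x * r x) \<le> e" if u: "\<And>x. x \<in> X \<Longrightarrow> u x \<le> e / (R + 1)" for u
    proof -
      have "(\<Sum>x\<in>X. u x * r x) \<le> (\<Sum>x\<in>X. e / (R + 1) * r x)"
        using u r(1) by (intro sum_mono mult_right_mono) auto
      also have "\<dots> = e / (R + 1) * (\<Sum>x\<in>X. r x)" by (simp add: sum_distrib_left)
      also have "\<dots> \<le> e / (R + 1) * (R + 1)" using rR eR by (intro mult_left_mono) auto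
      finally show ?thesis using R by simp
    qed
    have "(\<Sum>x\<in>X. g (x - t) * r x) \<le> h t + 3 * e" for t
    proof (cases "norm t \<le> L")
      case True
      then have "t \<in> cball 0 L" by simp
      then obtain s where s: "s \<in> T1" "dist t s < d1" "dist t s < d2"
        using T1(3) by fastforce
      have sT: "s \<in> T" "norm s \<le> L" using s(1) T(3) by (auto simp: T_def)
      have "(\<Sum>x\<in>X. (g (x - t) - g (x - s)) * r x) \<le> e"
      proof (rule small)
        fix x assume "x \<in> X"
        then have x: "x \<in> K" using X(2) by blast
        have "dist (x - t) (x - s) < d1" using s(2) by (simp add: dist_norm norm_minus_commute)
        then have "\<bar>g (x - t) - g (x - s)\<bar> < e / (R + 1)"
          using d1(2)[rule_format, OF near[OF x True] near[OF x sT(2)]] by blast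
        then show "g (x - t) - g (x - s) \<le> e / (R + 1)" by linarith
      qed
      then have "(\<Sum>x\<in>X. g (x - t) * r x) \<le> (\<Sum>x\<in>X. g (x - s) * r x) + e"
        by (simp add: algebra_simps sum_subtractf)
      moreover have "(\<Sum>x\<in>X. g (x - s) * r x) \<le> h s + e" using r(2) sT by blast
      moreover have "\<bar>h t - h s\<bar> < e" using d2(2)[rule_format, of t s] True sT(2) s(3) by simp
      ultimately show ?thesis by linarith
    next
      case False
      have "(\<Sum>x\<in>X. g (x - t) * r x) \<le> e"
      proof (rule small)
        fix x assume "x \<in> X"
        then show "g (x - t) \<le> e / (R + 1)" using far[of x t] X(2) False by auto
      qed
      then show ?thesis using h0[of t] e by linarith
    qed
    moreover have "V - 3 * e \<le> (\<Sum>x\<in>X. f x * r x)" using r(3) e by linarith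
    ultimately show ?thesis using X(1,2) r(1) rR by (intro exI[of _ X] exI[of _ r]) simp
  qed
  show ?thesis
  proof (rule that[OF R], intro allI impI)
    fix e :: real assume e: "0 < e"
    define e' where "e' = min 1 (e / 3)"
    have e': "0 < e'" "e' \<le> 1" "3 * e' \<le> e" using e by (auto simp: e'_def)
    obtain X r where *: "finite X" "X \<subseteq> K" "\<forall>x\<in>X. 0 \<le> r x" "(\<Sum>x\<in>X. r x) \<le> R"
      "\<And>t. (\<Sum>x\<in>X. g (x - t) * r x) \<le> h t + 3 * e'" "V - 3 * e' \<le> (\<Sum>x\<in>X. f x * r x)"
      using step[OF e'(1,2)] by blast
    have "(\<Sum>x\<in>X. g (x - t) * r x) \<le> h t + e" for t using *(5)[of t] e'(3) by linarith
    moreover have "V - e \<le> (\<Sum>x\<in>X. f x * r x)" using *(6) e'(3) by linarith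
    ultimately show "\<exists>X r. finite X \<and> X \<subseteq> K \<and> (\<forall>x\<in>X. 0 \<le> r x) \<and> (\<Sum>x\<in>X. r x) \<le> R
     \<and> (\<forall>t. (\<Sum>x\<in>X. g (x - t) * r x) \<le> h t + e) \<and> V - e \<le> (\<Sum>x\<in>X. f x * r x)"
      using *(1-4) by blast
  qed
qed

section \<open>Weak limits of point masses\<close>

text \<open>A clipped cosine that reads ternary digits: it is continuous with period 2, equals 0 on
  [0, 1/3] and 1 on [2/3, 1].\<close>

definition wave :: "real \<Rightarrow> real" where
  "wave t = max 0 (min 1 (1/2 - cos (pi * t)))"

lemma wave_bounds: "0 \<le> wave t" "wave t \<le> 1"
  by (auto simp: wave_def)

lemma continuous_wave: "continuous_on UNIV wave"
  unfolding wave_def by (intro continuous_intros)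

lemma wave_shift: "wave (2 * of_int N + s) = wave s"
proof -
  have "pi * (2 * of_int N + s) = 2 * pi * of_int N + pi * s" by (simp add: algebra_simps)
  then have "cos (pi * (2 * of_int N + s)) = cos (pi * s)"
    by (simp only: cos_add cos_int_2pin sin_int_2pin mult_1 mult_zero_left diff_zero)
  then show ?thesis by (simp only: wave_def)
qed

lemma wave_low: "0 \<le> s \<Longrightarrow> s \<le> 1/3 \<Longrightarrow> wave s = 0"
  using cos_monotone_0_pi_le[of "pi * s" "pi / 3"] by (simp add: wave_def cos_60 field_simps)

lemma wave_high:
  assumes "2/3 \<le> s" "s \<le> 1"
  shows "wave s = 1"
proof -
  have "cos (pi * s) \<le> cos (2 * pi / 3)"
    using assms by (intro cos_monotone_0_pi_le) (auto simp: field_simps)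
  then have "1 \<le> 1/2 - cos (pi * s)" by (simp add: cos_120)
  then show ?thesis by (simp add: wave_def)
qed

text \<open>Take the point of the Cantor set with ternary digits \<open>2 * d m\<close>. Multiplying
  it by \<open>3 ^ m\<close> yields an even integer plus the tail of the expansion;
  \<open>wave\<close> ignores the former and reads the leading digit of the latter.\<close>

lemma ternary_code:
  fixes d :: "nat \<Rightarrow> nat"
  assumes d: "\<And>m. d m \<le> 1"
  obtains t where "0 \<le> t" "t \<le> 1" "\<forall>m. wave (3 ^ m * t) = d m"
proof -
  define a where "a m i = 2 * real (d (m + i)) * (1/3) ^ Suc i" for m i
  define tail where "tail m = (\<Sum>i. a m i)" for m
  have geo: "(\<lambda>i. 2/3 * (1/3::real) ^ i) sums 1"
    using sums_mult[OF geometric_sums[of "1/3::real"], of "2/3"] by simp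
  have le: "a m i \<le> 2/3 * (1/3) ^ i" for m i
  proof -
    have "2 * real (d (m + i)) * (1/3) ^ Suc i \<le> 2 * (1/3) ^ Suc i"
      using d[of "m + i"] by (intro mult_right_mono) auto
    then show ?thesis by (simp add: a_def)
  qed
  have a0: "0 \<le> a m i" for m i by (simp add: a_def)
  have summ: "summable (a m)" for m
  proof (rule summable_comparison_test'[OF sums_summable[OF geo], of 0])
    show "norm (a m i) \<le> 2/3 * (1/3) ^ i" for i using a0[of m i] le[of m i] by simp
  qed
  have tail0: "0 \<le> tail m" for m
    unfolding tail_def by (rule suminf_nonneg[OF summ a0])
  have tail1: "tail m \<le> 1" for m
    using suminf_le[OF le[of m] summ sums_summable[OF geo]] sums_unique[OF geo]
    unfolding tail_def by linarith
  have step: "3 * tail m = 2 * d m + tail (Suc m)" for m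
  proof -
    have "a m (Suc i) = (1/3) * a (Suc m) i" for i by (simp add: a_def)
    then have "(\<Sum>i. a m (Suc i)) = (1/3) * tail (Suc m)"
      unfolding tail_def using suminf_mult[OF summ[of "Suc m"], of "1/3"] by presburger
    moreover have "(\<Sum>i. a m (Suc i)) = tail m - a m 0"
      unfolding tail_def by (rule suminf_split_head[OF summ])
    ultimately show ?thesis by (simp add: a_def)
  qed
  have shift: "\<exists>N::int. 3 ^ m * tail 0 = 2 * of_int N + tail m" for m
  proof (induction m)
    case 0
    show ?case by (intro exI[of _ 0]) simp
  next
    case (Suc m)
    then obtain N :: int where "3 ^ m * tail 0 = 2 * of_int N + tail m" by blast
    then have "3 ^ Suc m * tail 0 = 2 * of_int (3 * N + int (d m)) + tail (Suc m)"
      using step[of m] by simp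
    then show ?case by blast
  qed
  show ?thesis
  proof (rule that[of "tail 0"], rule_tac[3] allI)
    fix m
    obtain N :: int where "3 ^ m * tail 0 = 2 * of_int N + tail m" using shift by blast
    then have "wave (3 ^ m * tail 0) = wave (tail m)" by (simp add: wave_shift)
    also have "\<dots> = d m"
    \<comment> \<open>By \<open>step\<close>, digit 0 puts \<open>tail m\<close> into [0, 1/3] and
      digit 1 puts it into [2/3, 1].\<close>
    proof (cases "d m = 0")
      case True
      then show ?thesis using step[of m] tail0[of m] tail1[of "Suc m"] by (simp add: wave_low)
    next
      case False
      then have "d m = 1" using d[of m] by simp
      then show ?thesis using step[of m] tail1[of m] tail0[of "Suc m"] by (simp add: wave_high)
    qed
    finally show "wave (3 ^ m * tail 0) = d m" .
  qed (use tail0 tail1 in auto)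
qed

text \<open>Digits are read off from the floors of \<open>2 ^ k * y\<close>, so the partial sums
  telescope to dyadic truncations of \<open>y\<close>. The condition \<open>y < 1\<close> makes the
  integer part vanish.\<close>

lemma binary_digits:
  fixes y :: real
  assumes "0 \<le> y" "y < 1"
  obtains b :: "nat \<Rightarrow> nat" where "\<forall>k. b k \<le> 1" "(\<lambda>k. real (b k) * (1/2) ^ Suc k) sums y"
proof -
  define q where "q k = \<lfloor>2 ^ k * y\<rfloor>" for k :: nat
  have q: "of_int (q k) \<le> 2 ^ k * y" "2 ^ k * y < of_int (q k) + 1" for k
    unfolding q_def by linarith+
  define b where "b k = nat (q (Suc k) - 2 * q k)" for k
  have *: "0 \<le> q (Suc k) - 2 * q k \<and> q (Suc k) - 2 * q k \<le> 1" for k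
  proof -
    have "of_int (2 * q k) \<le> 2 ^ Suc k * y" using q(1)[of k] by simp
    then have "2 * q k \<le> q (Suc k)" unfolding q_def[of "Suc k"] by (simp only: le_floor_iff)
    moreover have "real_of_int (q (Suc k)) < of_int (2 * q k + 2)"
      using q(1)[of "Suc k"] q(2)[of k] by simp
    ultimately show ?thesis by linarith
  qed
  have b_eq: "real (b k) = of_int (q (Suc k)) - 2 * of_int (q k)" for k
    using *[of k] by (simp add: b_def)
  have q0: "q 0 = 0" using assms by (simp add: q_def floor_eq_iff)
  have part: "(\<Sum>k<n. real (b k) * (1/2) ^ Suc k) = of_int (q n) * (1/2) ^ n" for n
    by (induction n) (auto simp: q0 b_eq algebra_simps)
  have "(\<lambda>n. of_int (q n) * (1/2) ^ n) \<longlonglongrightarrow> y"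
  proof (rule Lim_null_comparison[THEN LIM_zero_cancel])
    have "\<bar>of_int (q n) * (1/2) ^ n - y\<bar> \<le> (1/2) ^ n" for n
    proof -
      have "of_int (q n) * (1/2) ^ n - y = (of_int (q n) - 2 ^ n * y) * (1/2) ^ n"
        by (simp add: field_simps)
      then have "\<bar>of_int (q n) * (1/2) ^ n - y\<bar> = \<bar>of_int (q n) - 2 ^ n * y\<bar> * (1/2) ^ n"
        by (simp only: abs_mult) simp
      also have "\<dots> \<le> 1 * (1/2) ^ n"
        using q[of n] by (intro mult_right_mono) auto
      finally show ?thesis by simp
    qed
    then show "\<forall>\<^sub>F n in sequentially. norm (of_int (q n) * (1/2) ^ n - y) \<le> (1/2) ^ n"
      by simp
  qed (simp add: LIMSEQ_power_zero)
  then have "(\<lambda>k. real (b k) * (1/2) ^ Suc k) sums y"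
    unfolding sums_def part .
  moreover have "\<forall>k. b k \<le> 1" using * by (simp add: b_def nat_le_iff)
  ultimately show ?thesis by (intro that)
qed

text \<open>For \<open>t\<close> in the Cantor set this is the number whose binary digits are the
  halved ternary digits of \<open>t\<close> at the positions \<open>n * k + j\<close>;
  \<open>wave\<close> extends it continuously to the line.\<close>

definition wave_series :: "nat \<Rightarrow> nat \<Rightarrow> real \<Rightarrow> real" where
  "wave_series n j t = (\<Sum>k. wave (3 ^ (n * k + j) * t) * (1/2) ^ Suc k)"

lemma wave_series_term: "norm (wave s * (1/2) ^ Suc k) \<le> (1/2) ^ Suc k"
  using wave_bounds[of s] mult_right_mono[of "wave s" 1 "(1/2) ^ Suc k"] by (simp add: abs_mult)

lemma continuous_wave_series: "continuous_on UNIV (wave_series n j)"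
proof -
  have "uniform_limit UNIV (\<lambda>N t. \<Sum>k<N. wave (3 ^ (n * k + j) * t) * (1/2) ^ Suc k) (wave_series n j) sequentially"
    unfolding wave_series_def
    by (rule Weierstrass_m_test[OF wave_series_term sums_summable[OF power_half_series]])
  moreover have "continuous_on UNIV (\<lambda>t. \<Sum>k<N. wave (3 ^ (n * k + j) * t) * (1/2) ^ Suc k)" for N
    by (intro continuous_intros continuous_on_compose2[OF continuous_wave]) auto
  ultimately show ?thesis
    by (intro uniform_limit_theorem[OF always_eventually]) auto
qed

lemma wave_series_bound: "\<bar>wave_series n j t\<bar> \<le> 1"
proof -
  have "norm (wave_series n j t) \<le> (\<Sum>k. (1/2) ^ Suc k)"
    unfolding wave_series_def
    by (rule norm_suminf_le[OF wave_series_term sums_summable[OF power_half_series]])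
  then show ?thesis using sums_unique[OF power_half_series, symmetric] by simp
qed

text \<open>Schoenberg's curve: for \<open>t\<close> in the Cantor set, coordinate \<open>j\<close> of \<open>p t\<close> has (up to an affine map) as binary digits the ternary digits of \<open>t\<close> (halved)
  at the positions congruent to \<open>j\<close> modulo the dimension.\<close>

lemma bounded_subset_of_curve:
  fixes K :: "'a::euclidean_space set"
  assumes "bounded K"
  obtains p :: "real \<Rightarrow> 'a" where "continuous_on UNIV p" "bounded (range p)" "K \<subseteq> p ` {0..1}"
proof -
  obtain B where B: "B > 0" "\<And>x. x \<in> K \<Longrightarrow> norm x \<le> B"
    using assms by (auto simp: bounded_pos)
  let ?n = "DIM('a)"
  obtain e where e: "bij_betw e {0..<?n} (Basis :: 'a set)"
    using ex_bij_betw_nat_finite[OF finite_Basis] by blast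
  define idx where "idx = inv_into {0..<?n} e"
  have idx: "idx b < ?n" "e (idx b) = b" if "b \<in> Basis" for b
    using that e inv_into_into[of b e "{0..<?n}"]
    by (auto simp: idx_def bij_betw_def f_inv_into_f)
  \<comment> \<open>The affine map takes [0, 1] to [-2B, 2B], twice what \<open>K\<close> needs, so
    the preimages \<open>y b\<close> below stay away from the endpoint 1 that
    \<open>binary_digits\<close> excludes.\<close>
  define p where "p t = (\<Sum>b\<in>Basis. (4 * B * wave_series ?n (idx b) t - 2 * B) *\<^sub>R b)" for t :: real
  have "continuous_on UNIV p"
    unfolding p_def by (intro continuous_intros continuous_wave_series)
  moreover have "bounded (range p)"
    unfolding bounded_iff
  proof (intro exI ballI)
    fix x assume "x \<in> range p"
    then obtain t where x: "x = p t" by blast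
    have "norm (p t) \<le> (\<Sum>b\<in>Basis. norm ((4 * B * wave_series ?n (idx b) t - 2 * B) *\<^sub>R (b::'a)))"
      unfolding p_def by (rule norm_sum)
    also have "\<dots> \<le> (\<Sum>b\<in>(Basis::'a set). 6 * B)"
    proof (rule sum_mono)
      fix b :: 'a assume b: "b \<in> Basis"
      define z where "z = 4 * B * wave_series ?n (idx b) t"
      have "\<bar>z\<bar> \<le> 4 * B * 1"
        unfolding z_def abs_mult using B(1) wave_series_bound[of ?n "idx b" t] by (intro mult_mono) auto
      then have "\<bar>z - 2 * B\<bar> \<le> 6 * B" using B(1) by linarith
      then show "norm ((4 * B * wave_series ?n (idx b) t - 2 * B) *\<^sub>R b) \<le> 6 * B"
        using b by (simp add: z_def)
    qed
    finally show "norm x \<le> (\<Sum>b\<in>(Basis::'a set). 6 * B)" using x by simp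
  qed
  moreover have "K \<subseteq> p ` {0..1}"
  proof
    fix x assume x: "x \<in> K"
    define y where "y b = (x \<bullet> b + 2 * B) / (4 * B)" for b
    have "\<exists>d::nat \<Rightarrow> nat. (\<forall>k. d k \<le> 1) \<and> (\<lambda>k. real (d k) * (1/2) ^ Suc k) sums y b" if "b \<in> Basis" for b
    proof -
      have "\<bar>x \<bullet> b\<bar> \<le> B" using Basis_le_norm[OF that, of x] B(2)[OF x] by linarith
      then have "0 \<le> y b" "y b < 1" using B(1) by (auto simp: y_def field_simps)
      then show ?thesis using binary_digits[of "y b"] by blast
    qed
    then have "\<exists>d::'a \<Rightarrow> nat \<Rightarrow> nat. \<forall>b\<in>Basis. (\<forall>k. d b k \<le> 1) \<and> (\<lambda>k. real (d b k) * (1/2) ^ Suc k) sums y b"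
      by (intro bchoice) blast
    then obtain d :: "'a \<Rightarrow> nat \<Rightarrow> nat" where
      d: "\<And>b k. b \<in> Basis \<Longrightarrow> d b k \<le> 1" "\<And>b. b \<in> Basis \<Longrightarrow> (\<lambda>k. real (d b k) * (1/2) ^ Suc k) sums y b"
      by blast
    have eB: "e (m mod ?n) \<in> Basis" for m
      using bij_betwE[OF e] by (simp add: DIM_positive)
    \<comment> \<open>Interleaving: position \<open>m\<close> stores digit \<open>m div ?n\<close>
      of the coordinate numbered \<open>m mod ?n\<close>.\<close>
    obtain t where t: "0 \<le> t" "t \<le> 1" "\<forall>m. wave (3 ^ m * t) = d (e (m mod ?n)) (m div ?n)"
      by (rule ternary_code[of "\<lambda>m. d (e (m mod ?n)) (m div ?n)", OF d(1)[OF eB]])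
    have "wave_series ?n (idx b) t = y b" if b: "b \<in> Basis" for b
      unfolding wave_series_def t(3)[rule_format] using idx[OF b] sums_unique[OF d(2)[OF b]] by simp
    then have "p t = (\<Sum>b\<in>Basis. (x \<bullet> b) *\<^sub>R b)"
      unfolding p_def using B(1) by (intro sum.cong) (auto simp: y_def)
    then have "p t = x" by (simp add: euclidean_representation)
    then show "x \<in> p ` {0..1}" using t(1,2) by force
  qed
  ultimately show ?thesis by (rule that)
qed

section \<open>Finitely supported Borel measures and their weak limits\<close>

lemma borel_point_masses:
  fixes X :: "'a::topological_space set" and v :: "'a \<Rightarrow> real"
  defines "P \<equiv> \<lambda>w. distr (point_measure X (\<lambda>x. ennreal (w x))) borel (\<lambda>x. x)"
  assumes X: "finite X" and w: "\<forall>x\<in>X. 0 \<le> w x"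
  shows "sets (P w) = sets borel"
    and "u \<in> borel_measurable borel \<Longrightarrow> (\<integral>\<^sup>+ x. u x \<partial>P w) = (\<Sum>x\<in>X. ennreal (w x) * u x)"
    and "v \<in> borel_measurable borel \<Longrightarrow> (\<integral>x. v x \<partial>P w) = (\<Sum>x\<in>X. w x * v x)"
proof -
  show "sets (P w) = sets borel" by (simp add: P_def)
  \<comment> \<open>A point measure carries the power set of \<open>X\<close>, so pushing it forward
    along the identity makes it a Borel measure.\<close>
  have id: "(\<lambda>x. x) \<in> measurable (point_measure X (\<lambda>x. ennreal (w x))) borel" by simp
  show "(\<integral>\<^sup>+ x. u x \<partial>P w) = (\<Sum>x\<in>X. ennreal (w x) * u x)" if "u \<in> borel_measurable borel"
    unfolding P_def using X that by (simp add: nn_integral_distr[OF id] nn_integral_point_measure_finite)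
  show "(\<integral>x. v x \<partial>P w) = (\<Sum>x\<in>X. w x * v x)" if "v \<in> borel_measurable borel"
    unfolding P_def integral_distr[OF id that]
    using lebesgue_integral_point_measure_finite[of X w v] X w by simp
qed

lemma real_distribution_point_masses:
  fixes A :: "real set"
  assumes A: "finite A" and w: "\<forall>x\<in>A. 0 \<le> w x" and one: "(\<Sum>x\<in>A. w x) = 1"
  shows "real_distribution (distr (point_measure A (\<lambda>x. ennreal (w x))) borel (\<lambda>x. x))"
proof -
  have "emeasure (point_measure A (\<lambda>x. ennreal (w x))) A = (\<Sum>x\<in>A. ennreal (w x))"
    using A by (rule emeasure_point_measure_finite) simp
  also have "\<dots> = 1" using w one by (subst sum_ennreal) auto
  finally interpret prob_space "point_measure A (\<lambda>x. ennreal (w x))"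
    by (intro prob_spaceI) (simp add: space_point_measure)
  show ?thesis by (rule real_distribution_distr) simp
qed

text \<open>Helly's theorem needs probability measures: the missing mass is put at the point 2, outside the parameter
  interval of the curve, and the cutoff \<open>cut\<close> removes it again in the limit.\<close>

lemma weakly_convergent_point_masses:
  fixes K :: "'a::euclidean_space set" and X :: "nat \<Rightarrow> 'a set" and r :: "nat \<Rightarrow> 'a \<Rightarrow> real"
  assumes K: "bounded K" and X: "\<And>n. finite (X n)" "\<And>n. X n \<subseteq> K"
    and r: "\<And>n x. x \<in> X n \<Longrightarrow> 0 \<le> r n x" "\<And>n. (\<Sum>x\<in>X n. r n x) \<le> R"
  obtains \<rho> s where "sets \<rho> = sets (borel :: 'a measure)" "strict_mono (s :: nat \<Rightarrow> nat)"
    "\<forall>\<phi> :: 'a \<Rightarrow> real. continuous_on UNIV \<phi> \<longrightarrow> (\<forall>x. 0 \<le> \<phi> x) \<longrightarrow> (\<exists>l. 0 \<le> l \<and>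
      (\<integral>\<^sup>+ x. ennreal (\<phi> x) \<partial>\<rho>) = ennreal l \<and> (\<lambda>n. \<Sum>x\<in>X (s n). \<phi> x * r (s n) x) \<longlonglongrightarrow> l)"
proof -
  obtain p :: "real \<Rightarrow> 'a" where p: "continuous_on UNIV p" "bounded (range p)" "K \<subseteq> p ` {0..1}"
    by (rule bounded_subset_of_curve[OF K])
  have "\<forall>x\<in>K. \<exists>t. t \<in> {0..1} \<and> p t = x" using p(3) by blast
  \<comment> \<open>A pointwise choice of parameters; no measurability of \<open>\<sigma>\<close>
    arises, since it is applied only to the finite sets \<open>X n\<close>.\<close>
  then obtain \<sigma> where \<sigma>: "\<And>x. x \<in> K \<Longrightarrow> \<sigma> x \<in> {0..1}" "\<And>x. x \<in> K \<Longrightarrow> p (\<sigma> x) = x"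
    using bchoice[of K "\<lambda>x t. t \<in> {0..1} \<and> p t = x"] by blast
  have inj: "inj_on \<sigma> (X n)" for n
    by (rule inj_on_inverseI[of _ p]) (use \<sigma>(2) X(2) in blast)
  have "0 \<le> (\<Sum>x\<in>X 0. r 0 x)" using r(1) by (rule sum_nonneg)
  then have R: "0 \<le> R" using r(2)[of 0] by linarith
  \<comment> \<open>The added 1 makes the normalising constant positive even when
    \<open>R = 0\<close>.\<close>
  define R' where "R' = R + 1"
  have R': "0 < R'" using R by (simp add: R'_def)
  define A where "A n = insert 2 (\<sigma> ` X n)" for n
  define w where "w n t = (if t = 2 then 1 - (\<Sum>x\<in>X n. r n x) / R' else r n (p t) / R')" for n t
  have two: "2 \<notin> \<sigma> ` X n" for n using \<sigma>(1) X(2)[of n] by force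
  have A: "finite (A n)" "A n \<subseteq> {0..2}" for n
    using X \<sigma>(1) by (fastforce simp: A_def)+
  have w_\<sigma>: "w n (\<sigma> x) = r n x / R'" if "x \<in> X n" for n x
  proof -
    have "\<sigma> x \<noteq> 2" using two[of n] imageI[OF that, of \<sigma>] by metis
    moreover have "p (\<sigma> x) = x" using \<sigma>(2) X(2) that by blast
    ultimately show ?thesis by (simp add: w_def)
  qed
  have sum_A: "(\<Sum>t\<in>A n. F t) = F 2 + (\<Sum>x\<in>X n. F (\<sigma> x))" for n and F :: "real \<Rightarrow> real"
    unfolding A_def using X(1) two by (simp add: sum.reindex[OF inj])
  have w2: "0 \<le> w n 2" for n
    using r(2)[of n] R' by (simp add: w_def R'_def)
  have w0: "\<forall>t\<in>A n. 0 \<le> w n t" for n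
    using w2 w_\<sigma> r(1) R' by (auto simp: A_def)
  have w1: "(\<Sum>t\<in>A n. w n t) = 1" for n
    unfolding sum_A using w_\<sigma> by (simp add: sum_divide_distrib[symmetric]) (simp add: w_def)
  define \<pi> where "\<pi> n = distr (point_measure (A n) (\<lambda>t. ennreal (w n t))) borel (\<lambda>t. t)" for n
  have dist: "real_distribution (\<pi> n)" for n
    unfolding \<pi>_def by (rule real_distribution_point_masses[OF A(1) w0 w1])
  \<comment> \<open>All atoms lie in [0, 2], so one interval carries every \<open>\<pi> n\<close>;
    this gives tightness.\<close>
  have "measure (\<pi> n) {-1<..3} = 1" for n
  proof -
    have "emeasure (\<pi> n) {-1<..3} = (\<integral>\<^sup>+ t. indicator {-1<..3} t \<partial>\<pi> n)"
      by (simp add: \<pi>_def)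
    also have "\<dots> = (\<Sum>t\<in>A n. ennreal (w n t) * indicator {-1<..3} t)"
      unfolding \<pi>_def by (rule borel_point_masses(2)[OF A(1) w0]) simp
    also have "\<dots> = (\<Sum>t\<in>A n. ennreal (w n t))"
      using A(2)[of n] by (intro sum.cong) (auto simp: indicator_def)
    also have "\<dots> = 1" using w0[of n] w1[of n] by (subst sum_ennreal) auto
    finally show ?thesis by (simp add: measure_def)
  qed
  then have "tight \<pi>"
    unfolding tight_def using dist by (intro conjI allI impI exI[of _ "-1"] exI[of _ 3]) auto
  then obtain s \<nu> where s: "strict_mono s" and \<nu>: "real_distribution \<nu>" "weak_conv_m (\<pi> \<circ> s) \<nu>"
    using tight_imp_convergent_subsubsequence[of \<pi> id] by (auto simp: strict_mono_id)
  interpret \<nu>: real_distribution \<nu> by (rule \<nu>(1))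
  \<comment> \<open>\<open>cut\<close> is continuous, equals \<open>R'\<close> on [0, 1] and
    vanishes from 2 on: it undoes the normalisation and kills the auxiliary atom.\<close>
  define cut where "cut t = R' * max 0 (min 1 (2 - t))" for t :: real
  have cut: "0 \<le> cut t" "cut t \<le> R'" for t using R' by (auto simp: cut_def mult_left_le)
  have cut_borel: "cut \<in> borel_measurable borel" unfolding cut_def by measurable
  have p_borel: "p \<in> borel_measurable borel" using p(1) by (rule borel_measurable_continuous_onI)
  define \<rho> where "\<rho> = distr (density \<nu> (\<lambda>t. ennreal (cut t))) borel p"
  show ?thesis
  proof (rule that[OF _ s, of \<rho>], goal_cases)
    case 1
    show ?case by (simp add: \<rho>_def)
  next
    case 2
    show ?case
    proof (intro allI impI)
      fix \<phi> :: "'a \<Rightarrow> real"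
      assume \<phi>: "continuous_on UNIV \<phi>" "\<forall>x. 0 \<le> \<phi> x"
      have \<phi>_borel: "\<phi> \<in> borel_measurable borel" using \<phi>(1) by (rule borel_measurable_continuous_onI)
      define F where "F t = cut t * \<phi> (p t)" for t
      have F0: "0 \<le> F t" for t using cut \<phi>(2) by (simp add: F_def)
      have "continuous_on UNIV F"
        unfolding F_def cut_def
        by (intro continuous_intros continuous_on_compose2[OF \<phi>(1)] p(1)) auto
      then have Fc: "isCont F t" for t by (simp add: continuous_on_eq_continuous_at)
      have F_borel: "F \<in> borel_measurable borel"
        using \<open>continuous_on UNIV F\<close> by (rule borel_measurable_continuous_onI)
      \<comment> \<open>The test function \<open>\<phi>\<close> may be unbounded, but only its
        values along the bounded curve enter \<open>F\<close>.\<close>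
      have "compact (closure (range p))" using p(2) by simp
      then have "bounded (\<phi> ` closure (range p))"
        by (intro compact_imp_bounded compact_continuous_image continuous_on_subset[OF \<phi>(1)]) auto
      then obtain b where b: "\<And>x. x \<in> closure (range p) \<Longrightarrow> norm (\<phi> x) \<le> b"
        unfolding bounded_iff by blast
      have bt: "\<phi> (p t) \<le> b" for t using b[of "p t"] closure_subset[of "range p"] by force
      have Fb: "norm (F t) \<le> R' * b" for t
        using cut[of t] bt[of t] \<phi>(2) R' F0[of t] unfolding F_def by (simp add: mult_mono)
      have int: "(\<integral>t. F t \<partial>\<pi> n) = (\<Sum>x\<in>X n. \<phi> x * r n x)" for n
      proof -
        have "(\<integral>t. F t \<partial>\<pi> n) = (\<Sum>t\<in>A n. w n t * F t)"
          unfolding \<pi>_def by (rule borel_point_masses(3)[OF A(1) w0 F_borel])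
        also have "\<dots> = (\<Sum>x\<in>X n. w n (\<sigma> x) * F (\<sigma> x))"
          unfolding sum_A by (simp add: F_def cut_def)
        also have "\<dots> = (\<Sum>x\<in>X n. \<phi> x * r n x)"
        proof (rule sum.cong[OF refl])
          fix x assume x: "x \<in> X n"
          then have "x \<in> K" using X(2) by blast
          then have "F (\<sigma> x) = R' * \<phi> x" using \<sigma>(1)[of x] \<sigma>(2)[of x] by (simp add: F_def cut_def)
          then show "w n (\<sigma> x) * F (\<sigma> x) = \<phi> x * r n x" using w_\<sigma>[OF x] R' by simp
        qed
        finally show ?thesis .
      qed
      have "(\<lambda>n. \<integral>t. F t \<partial>((\<pi> \<circ> s) n)) \<longlonglongrightarrow> (\<integral>t. F t \<partial>\<nu>)"
        by (rule weak_conv_imp_integral_bdd_continuous_conv[OF _ \<nu> Fc Fb]) (simp add: dist)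
      then have lim: "(\<lambda>n. \<Sum>x\<in>X (s n). \<phi> x * r (s n) x) \<longlonglongrightarrow> (\<integral>t. F t \<partial>\<nu>)"
        by (simp add: int)
      have "integrable \<nu> F"
        using Fb F_borel by (intro \<nu>.integrable_const_bound[of _ "R' * b"]) auto
      then have "(\<integral>\<^sup>+ t. ennreal (F t) \<partial>\<nu>) = ennreal (\<integral>t. F t \<partial>\<nu>)"
        using F0 by (intro nn_integral_eq_integral) auto
      moreover have "(\<integral>\<^sup>+ x. ennreal (\<phi> x) \<partial>\<rho>) = (\<integral>\<^sup>+ t. ennreal (F t) \<partial>\<nu>)"
      proof -
        have "(\<integral>\<^sup>+ x. ennreal (\<phi> x) \<partial>\<rho>) = (\<integral>\<^sup>+ t. ennreal (\<phi> (p t)) \<partial>density \<nu> (\<lambda>t. ennreal (cut t)))"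
          unfolding \<rho>_def using p_borel \<phi>_borel by (intro nn_integral_distr) (auto cong: measurable_cong_sets)
        also have "\<dots> = (\<integral>\<^sup>+ t. ennreal (cut t) * ennreal (\<phi> (p t)) \<partial>\<nu>)"
          using p_borel \<phi>_borel cut_borel
          by (intro nn_integral_density) (auto intro: measurable_compose cong: measurable_cong_sets)
        finally show ?thesis using cut \<phi>(2) by (simp add: F_def ennreal_mult)
      qed
      moreover have "0 \<le> (\<integral>t. F t \<partial>\<nu>)" using F0 by simp
      ultimately show "\<exists>l. 0 \<le> l \<and> (\<integral>\<^sup>+ x. ennreal (\<phi> x) \<partial>\<rho>) = ennreal l \<and>
          (\<lambda>n. \<Sum>x\<in>X (s n). \<phi> x * r (s n) x) \<longlonglongrightarrow> l"
        using lim by metis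
    qed
  qed
qed

section \<open>Duality\<close>

text \<open>Since \<open>g\<close> is bounded below on a small ball about \<open>x0\<close>, the
  packing integrals bound the measure of every ball of that radius, and by Lindelof countably many
  of them cover the space. This provides the hypothesis of Tonelli's theorem, as Borel measures here
  are arbitrary.\<close>

lemma sigma_finite_of_packing:
  fixes g :: "'a::euclidean_space \<Rightarrow> real"
  assumes g: "continuous_on UNIV g" and gx0: "0 < g x0"
    and \<rho>: "sets \<rho> = sets borel" and fin: "\<And>t. (\<integral>\<^sup>+ x. ennreal (g (x - t)) \<partial>\<rho>) < \<infinity>"
  shows "sigma_finite_measure \<rho>"
proof -
  have "open {y. g x0 / 2 < g y}" using open_Collect_less[OF continuous_on_const g] .
  then obtain d where d: "d > 0" "ball x0 d \<subseteq> {y. g x0 / 2 < g y}"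
    using gx0 by (force elim: openE)
  have ball_fin: "emeasure \<rho> (ball a d) \<noteq> \<infinity>" for a
  proof -
    have "ennreal (g x0 / 2) * emeasure \<rho> (ball a d) = (\<integral>\<^sup>+ x. ennreal (g x0 / 2) * indicator (ball a d) x \<partial>\<rho>)"
      using \<rho> by (subst nn_integral_cmult_indicator) auto
    \<comment> \<open>The shift by \<open>a - x0\<close> carries the ball about \<open>x0\<close> to
      the ball about \<open>a\<close>.\<close>
    also have "\<dots> \<le> (\<integral>\<^sup>+ x. ennreal (g (x - (a - x0))) \<partial>\<rho>)"
    proof (intro nn_integral_mono)
      fix x
      show "ennreal (g x0 / 2) * indicator (ball a d) x \<le> ennreal (g (x - (a - x0)))"
      proof (cases "x \<in> ball a d")
        case True
        then have "x - (a - x0) \<in> ball x0 d" by (simp add: dist_norm norm_minus_commute)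
        then have "g x0 / 2 < g (x - (a - x0))" using d(2) by blast
        then show ?thesis using True by (simp add: ennreal_leI)
      qed simp
    qed
    also have "\<dots> < \<infinity>" by (rule fin)
    finally show ?thesis using gx0 by (auto simp: ennreal_mult_less_top less_top[symmetric] ennreal_eq_0_iff)
  qed
  have "\<And>S. S \<in> range (\<lambda>a::'a. ball a d) \<Longrightarrow> open S" by auto
  then obtain F where F: "F \<subseteq> range (\<lambda>a::'a. ball a d)" "countable F" "\<Union>F = \<Union>(range (\<lambda>a::'a. ball a d))"
    using Lindelof by metis
  have "\<Union>(range (\<lambda>a::'a. ball a d)) = UNIV" using d(1) by (auto intro!: exI[of _ "ball _ d"])
  moreover have "space \<rho> = UNIV" using \<rho> by (metis sets_eq_imp_space_eq space_borel)
  ultimately show ?thesis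
    using F \<rho> ball_fin by (intro sigma_finite_measure.intro exI[of _ F]) auto
qed

text \<open>By Markov's inequality each set where \<open>h\<close> exceeds \<open>1 / Suc n\<close>
  has finite measure. These sets exhaust the positivity set, and its complement is null for the
  density.\<close>

lemma sigma_finite_density_positive:
  assumes h: "(h :: 'a \<Rightarrow> real) \<in> borel_measurable \<mu>" and fin: "(\<integral>\<^sup>+ x. ennreal (h x) \<partial>\<mu>) < \<infinity>"
  shows "sigma_finite_measure (density \<mu> (indicator {x \<in> space \<mu>. 0 < h x}))"
proof -
  let ?P = "{x \<in> space \<mu>. 0 < h x}"
  define A where "A n = {x \<in> space \<mu>. 1 / real (Suc n) < h x}" for n
  have P[measurable]: "?P \<in> sets \<mu>" and A: "A n \<in> sets \<mu>" for n
    using h unfolding A_def by measurable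
  have em: "emeasure (density \<mu> (indicator ?P)) B = emeasure \<mu> (?P \<inter> B)" if "B \<in> sets \<mu>" for B
    using that P by (simp add: emeasure_density indicator_inter_arith[symmetric] mult.commute Int_commute)
  have A_fin: "emeasure \<mu> (A n) < \<infinity>" for n
  proof -
    have "ennreal (1 / real (Suc n)) * emeasure \<mu> (A n) = (\<integral>\<^sup>+ x. ennreal (1 / real (Suc n)) * indicator (A n) x \<partial>\<mu>)"
      using A by (subst nn_integral_cmult_indicator) auto
    also have "\<dots> \<le> (\<integral>\<^sup>+ x. ennreal (h x) \<partial>\<mu>)"
      by (intro nn_integral_mono) (auto simp: A_def indicator_def intro!: ennreal_leI)
    also have "\<dots> < \<infinity>" by (rule fin)
    finally show ?thesis by (auto simp: ennreal_mult_less_top ennreal_mult_eq_top_iff less_top)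
  qed
  show ?thesis
  proof (intro sigma_finite_measure.intro exI[of _ "insert (space \<mu> - ?P) (range A)"] conjI ballI)
    show "\<Union> (insert (space \<mu> - ?P) (range A)) = space (density \<mu> (indicator ?P))"
    proof -
      have "\<exists>n. x \<in> A n" if "x \<in> ?P" for x
        using that reals_Archimedean[of "h x"] by (auto simp: A_def inverse_eq_divide)
      moreover have "A n \<subseteq> space \<mu>" for n by (auto simp: A_def)
      ultimately show ?thesis by (auto simp: space_density)
    qed
    fix B assume B: "B \<in> insert (space \<mu> - ?P) (range A)"
    show "emeasure (density \<mu> (indicator ?P)) B \<noteq> \<infinity>"
    proof (cases "B = space \<mu> - ?P")
      case True
      then have "emeasure (density \<mu> (indicator ?P)) B = emeasure \<mu> (?P \<inter> B)" by (intro em) auto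
      moreover have "?P \<inter> B = {}" using True by blast
      ultimately show ?thesis by simp
    next
      case False
      then obtain n where n: "B = A n" using B by blast
      have "emeasure (density \<mu> (indicator ?P)) B \<le> emeasure \<mu> (A n)"
        unfolding n em[OF A] using A by (intro emeasure_mono) auto
      then show ?thesis using A_fin[of n] by (auto simp: top_unique)
    qed
  qed (use A P in auto)
qed

text \<open>The covering measure \<open>\<mu>\<close> may fail to be \<open>\<sigma>\<close>-finite on the zero set of \<open>h\<close>, but points
  there see only a \<open>\<rho>\<close>-null set, so Tonelli is applied to \<open>\<mu>\<close> restricted to \<open>{h > 0}\<close>.\<close>

lemma weak_duality:
  fixes f g h :: "'a::euclidean_space \<Rightarrow> real"
  assumes g: "continuous_on UNIV g" and h: "continuous_on UNIV h"
    and g0: "\<And>x. 0 \<le> g x" and gx0: "0 < g x0" and h0: "\<And>x. 0 \<le> h x"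
    and \<mu>: "\<mu> \<in> borel_measures" "\<forall>x. ennreal (f x) \<le> conv \<mu> g x"
    and \<rho>: "\<rho> \<in> borel_measures" "\<forall>x. conv \<rho> (reflect g) x \<le> ennreal (h x)"
  shows "(\<integral>\<^sup>+ x. ennreal (f x) \<partial>\<rho>) \<le> (\<integral>\<^sup>+ x. ennreal (h x) \<partial>\<mu>)"
proof (cases "(\<integral>\<^sup>+ x. ennreal (h x) \<partial>\<mu>) < \<infinity>")
  case False
  then show ?thesis by (simp add: less_top[symmetric])
next
  case True
  have sets: "sets \<mu> = sets borel" "sets \<rho> = sets borel"
    using \<mu>(1) \<rho>(1) by (auto simp: borel_measures_def)
  then have space: "space \<mu> = UNIV" "space \<rho> = UNIV"
    by (metis sets_eq_imp_space_eq space_borel)+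
  have packing: "(\<integral>\<^sup>+ x. ennreal (g (x - t)) \<partial>\<rho>) \<le> ennreal (h t)" for t
    using \<rho>(2)[rule_format, of t] by (simp add: conv_def reflect_def)
  define \<mu>' where "\<mu>' = density \<mu> (indicator {x \<in> space \<mu>. 0 < h x})"
  have [measurable]: "g \<in> borel_measurable borel" "h \<in> borel_measurable borel"
    using g h by (auto intro: borel_measurable_continuous_onI)
  have h_\<mu>: "h \<in> borel_measurable \<mu>" by (simp add: measurable_cong_sets[OF sets(1) refl])
  have P[measurable]: "{x \<in> space \<mu>. 0 < h x} \<in> sets \<mu>" using h_\<mu> by measurable
  have sets': "sets \<mu>' = sets borel" by (simp add: \<mu>'_def sets)
  interpret \<mu>': sigma_finite_measure \<mu>'
    unfolding \<mu>'_def by (rule sigma_finite_density_positive[OF h_\<mu> True])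
  interpret \<rho>: sigma_finite_measure \<rho>
    by (rule sigma_finite_of_packing[OF g gx0 sets(2)]) (rule le_less_trans[OF packing], simp)
  interpret pair_sigma_finite \<mu>' \<rho> ..
  have restrict: "(\<integral>\<^sup>+ t. u t \<partial>\<mu>') = (\<integral>\<^sup>+ t. indicator {t. 0 < h t} t * u t \<partial>\<mu>)"
    if "u \<in> borel_measurable borel" for u
    unfolding \<mu>'_def using that P by (subst nn_integral_density)
      (auto simp: space measurable_cong_sets[OF sets(1) refl])
  define W where "W t = {x. 0 < g (x - t)}" for t
  have W: "open (W t)" for t
    unfolding W_def by (intro open_Collect_less continuous_intros continuous_on_compose2[OF g]) auto
  \<comment> \<open>At a zero of \<open>h\<close> the packing constraint leaves no mass where the
    translate of \<open>g\<close> is positive.\<close>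
  have W_null: "emeasure \<rho> (W t) = 0" if "h t = 0" for t
  proof -
    have "(\<integral>\<^sup>+ x. ennreal (g (x - t)) \<partial>\<rho>) = 0" using packing[of t] that by simp
    then have "emeasure \<rho> {x \<in> space \<rho>. ennreal (g (x - t)) \<noteq> 0} = 0"
      by (subst (asm) nn_integral_0_iff) (auto simp: measurable_cong_sets[OF sets(2) refl])
    moreover have "{x \<in> space \<rho>. ennreal (g (x - t)) \<noteq> 0} = W t"
      using g0 by (auto simp: W_def space ennreal_eq_0_iff not_le)
    ultimately show ?thesis by simp
  qed
  \<comment> \<open>The zero set of \<open>h\<close> may be uncountable; since the sets
    \<open>W t\<close> are open, Lindelof reduces their union to a countable union of null
    sets.\<close>
  have "\<And>S. S \<in> W ` {t. h t = 0} \<Longrightarrow> open S" using W by blast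
  then obtain F where F: "F \<subseteq> W ` {t. h t = 0}" "countable F" "\<Union>F = \<Union>(W ` {t. h t = 0})"
    using Lindelof by metis
  have "AE x in \<rho>. x \<notin> S" if S: "S \<in> F" for S
  proof -
    obtain t where "S = W t" "h t = 0" using S F(1) by blast
    then have "S \<in> null_sets \<rho>" using W W_null sets by (auto simp: null_sets_def)
    then show ?thesis by (rule AE_not_in)
  qed
  then have "AE x in \<rho>. \<forall>S\<in>F. x \<notin> S"
    using AE_ball_countable[OF F(2), of "\<lambda>x S. x \<notin> S" \<rho>] by blast
  then have AE_f: "AE x in \<rho>. ennreal (f x) \<le> (\<integral>\<^sup>+ t. ennreal (g (x - t)) \<partial>\<mu>')"
  proof (rule AE_mp[OF _ AE_I2], intro impI)
    fix x assume "\<forall>S\<in>F. x \<notin> S"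
    then have "x \<notin> \<Union>(W ` {t. h t = 0})" unfolding F(3)[symmetric] by blast
    then have x: "g (x - t) = 0" if "h t = 0" for t
      using that g0[of "x - t"] by (auto simp: W_def intro: antisym)
    have "ennreal (f x) \<le> (\<integral>\<^sup>+ t. ennreal (g (x - t)) \<partial>\<mu>)"
      using \<mu>(2) by (simp add: conv_def)
    also have "\<dots> = (\<integral>\<^sup>+ t. indicator {t. 0 < h t} t * ennreal (g (x - t)) \<partial>\<mu>)"
    proof (rule nn_integral_cong)
      fix t
      show "ennreal (g (x - t)) = indicator {t. 0 < h t} t * ennreal (g (x - t))"
        using x[of t] h0[of t] by (cases "h t = 0") (simp_all add: indicator_def)
    qed
    also have "\<dots> = (\<integral>\<^sup>+ t. ennreal (g (x - t)) \<partial>\<mu>')"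
      by (rule restrict[symmetric]) measurable
    finally show "ennreal (f x) \<le> (\<integral>\<^sup>+ t. ennreal (g (x - t)) \<partial>\<mu>')" .
  qed
  have "(\<lambda>(t, x). ennreal (g (x - t))) \<in> borel_measurable (borel \<Otimes>\<^sub>M borel)"
    by measurable
  then have meas: "(\<lambda>(t, x). ennreal (g (x - t))) \<in> borel_measurable (\<mu>' \<Otimes>\<^sub>M \<rho>)"
    by (simp only: measurable_cong_sets[OF sets_pair_measure_cong[OF sets' sets(2)] refl])
  have "(\<integral>\<^sup>+ x. ennreal (f x) \<partial>\<rho>) \<le> (\<integral>\<^sup>+ x. \<integral>\<^sup>+ t. ennreal (g (x - t)) \<partial>\<mu>' \<partial>\<rho>)"
    by (rule nn_integral_mono_AE[OF AE_f])
  also have "\<dots> = (\<integral>\<^sup>+ t. \<integral>\<^sup>+ x. ennreal (g (x - t)) \<partial>\<rho> \<partial>\<mu>')"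
    by (rule Fubini'[OF meas])
  also have "\<dots> \<le> (\<integral>\<^sup>+ t. ennreal (h t) \<partial>\<mu>')"
    by (intro nn_integral_mono packing)
  also have "\<dots> = (\<integral>\<^sup>+ t. indicator {t. 0 < h t} t * ennreal (h t) \<partial>\<mu>)"
    by (rule restrict) measurable
  also have "\<dots> \<le> (\<integral>\<^sup>+ x. ennreal (h x) \<partial>\<mu>)"
    by (intro nn_integral_mono) (auto simp: indicator_def)
  finally show ?thesis .
qed

section \<open>Strong duality and attainment\<close>

lemma covering_number_le_finite_sum:
  fixes f g h :: "'a::euclidean_space \<Rightarrow> real"
  assumes g: "continuous_on UNIV g" "\<And>x. 0 \<le> g x" and h: "continuous_on UNIV h" "\<And>x. 0 \<le> h x"
    and T: "finite T" and m: "\<forall>t\<in>T. 0 \<le> m t"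
    and cover: "\<forall>x. f x \<le> (\<Sum>t\<in>T. g (x - t) * m t)"
  shows "covering_number h f g \<le> ennreal (\<Sum>t\<in>T. h t * m t)"
proof -
  define \<mu> where "\<mu> = distr (point_measure T (\<lambda>t. ennreal (m t))) borel (\<lambda>t. t)"
  have integral: "(\<integral>\<^sup>+ t. ennreal (u t) \<partial>\<mu>) = ennreal (\<Sum>t\<in>T. u t * m t)"
    if u: "continuous_on UNIV u" "\<And>t. 0 \<le> u t" for u
  proof -
    have "(\<lambda>t. ennreal (u t)) \<in> borel_measurable borel"
      using borel_measurable_continuous_onI[OF u(1)] by measurable
    then have "(\<integral>\<^sup>+ t. ennreal (u t) \<partial>\<mu>) = (\<Sum>t\<in>T. ennreal (m t) * ennreal (u t))"
      unfolding \<mu>_def by (rule borel_point_masses(2)[OF T m])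
    also have "\<dots> = (\<Sum>t\<in>T. ennreal (u t * m t))"
      using m u(2) by (intro sum.cong) (auto simp: ennreal_mult mult.commute)
    also have "\<dots> = ennreal (\<Sum>t\<in>T. u t * m t)"
      using m u(2) by (intro sum_ennreal) auto
    finally show ?thesis .
  qed
  have "\<mu> \<in> borel_measures" by (simp add: \<mu>_def borel_measures_def)
  moreover have "ennreal (f x) \<le> conv \<mu> g x" for x
  proof -
    have "continuous_on UNIV (\<lambda>t. g (x - t))"
      by (intro continuous_on_compose2[OF g(1)] continuous_intros) auto
    then have "conv \<mu> g x = ennreal (\<Sum>t\<in>T. g (x - t) * m t)"
      unfolding conv_def using g(2) by (intro integral) auto
    then show ?thesis using cover by (simp add: ennreal_leI)
  qed
  ultimately have "covering_number h f g \<le> (\<integral>\<^sup>+ t. ennreal (h t) \<partial>\<mu>)"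
    unfolding covering_number_def by (intro Inf_lower) blast
  also have "\<dots> = ennreal (\<Sum>t\<in>T. h t * m t)" using h by (intro integral)
  finally show ?thesis .
qed

text \<open>Finitely many translates of \<open>g\<close>, each with weight \<open>b / c\<close>,
  already dominate the bounded function \<open>f\<close> on \<open>K\<close>.\<close>

lemma covering_number_finite:
  fixes f g h :: "'a::euclidean_space \<Rightarrow> real"
  assumes g: "continuous_on UNIV g" "\<And>x. 0 \<le> g x" "0 < g x0"
    and h: "continuous_on UNIV h" "\<And>x. 0 \<le> h x"
    and f: "continuous_on UNIV f" and K: "compact K" "\<And>x. x \<notin> K \<Longrightarrow> f x = 0"
  shows "covering_number h f g < \<infinity>"
proof -
  obtain T c where T: "finite T" "0 < c" "\<forall>x\<in>K. \<exists>t\<in>T. c \<le> g (x - t)"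
    by (rule finite_translates_cover[OF g(1) K(1) g(3)])
  have "compact (f ` K)" using f K(1) by (intro compact_continuous_image continuous_on_subset[OF f]) auto
  then obtain b where b: "0 < b" "\<And>x. x \<in> K \<Longrightarrow> norm (f x) \<le> b"
    using compact_imp_bounded bounded_pos by (metis imageI)
  have "f x \<le> (\<Sum>t\<in>T. g (x - t) * (b / c))" for x
  proof (cases "x \<in> K")
    case True
    then obtain t where t: "t \<in> T" "c \<le> g (x - t)" using T(3) by blast
    have "f x \<le> c * (b / c)" using b(2)[OF True] T(2) by simp
    also have "\<dots> \<le> g (x - t) * (b / c)" using t(2) b(1) T(2) by (intro mult_right_mono) auto
    also have "\<dots> \<le> (\<Sum>t\<in>T. g (x - t) * (b / c))"
      using t(1) T(1,2) b(1) g(2) by (intro member_le_sum) auto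
    finally show ?thesis .
  next
    case False
    then show ?thesis using K(2) T(2) b(1) g(2) by (auto intro!: sum_nonneg)
  qed
  then have "covering_number h f g \<le> ennreal (\<Sum>t\<in>T. h t * (b / c))"
    using T(1,2) b(1) by (intro covering_number_le_finite_sum[OF g(1,2) h]) auto
  then show ?thesis by (rule le_less_trans) simp
qed

text \<open>Approximate maximisers have uniformly bounded mass on \<open>K\<close>, so a subsequence
  converges weakly. Both \<open>f\<close> and the translates of \<open>g\<close> are admissible test
  functions, hence the objective and every constraint pass to the limit.\<close>

lemma optimal_separation:
  fixes f g h :: "'a::euclidean_space \<Rightarrow> real"
  assumes f: "continuous_on UNIV f" "\<And>x. 0 \<le> f x" and g: "g \<in> C0" "\<And>x. 0 \<le> g x" "0 < g x0"
    and h: "continuous_on UNIV h" "\<And>x. 0 \<le> h x"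
    and K: "compact K" "\<And>x. x \<notin> K \<Longrightarrow> f x = 0"
  obtains \<rho> where "\<rho> \<in> borel_measures" "\<forall>x. conv \<rho> (reflect g) x \<le> ennreal (h x)"
    "covering_number h f g \<le> (\<integral>\<^sup>+ x. ennreal (f x) \<partial>\<rho>)"
proof -
  have gc: "continuous_on UNIV g" using g(1) by (simp add: C0_def)
  have fin: "covering_number h f g < \<infinity>"
    by (rule covering_number_finite[OF gc g(2,3) h f(1) K])
  \<comment> \<open>Finiteness is essential here, because \<open>enn2real\<close> sends infinity to
    0.\<close>
  define V where "V = enn2real (covering_number h f g)"
  have V: "covering_number h f g = ennreal V" using fin by (simp add: V_def)
  have V_le: "V \<le> (\<Sum>t\<in>T. h t * m t)"
    if "finite T" "\<forall>t\<in>T. 0 \<le> m t" "\<forall>x. f x \<le> (\<Sum>t\<in>T. g (x - t) * m t)" for T m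
  proof -
    have "covering_number h f g \<le> ennreal (\<Sum>t\<in>T. h t * m t)"
      by (rule covering_number_le_finite_sum[OF gc g(2) h that])
    moreover have "0 \<le> (\<Sum>t\<in>T. h t * m t)" using that(2) h(2) by (auto intro!: sum_nonneg)
    ultimately show ?thesis by (simp add: V)
  qed
  obtain R where R: "0 \<le> R" "\<forall>e>0. \<exists>X r. finite X \<and> X \<subseteq> K \<and> (\<forall>x\<in>X. 0 \<le> r x) \<and> (\<Sum>x\<in>X. r x) \<le> R
     \<and> (\<forall>t. (\<Sum>x\<in>X. g (x - t) * r x) \<le> h t + e) \<and> V - e \<le> (\<Sum>x\<in>X. f x * r x)"
    by (rule approximate_separation[OF f(1) g(1) h(1) g(2) h(2) g(3) K V_le])
  define e where "e n = 1 / real (Suc n)" for n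
  have "\<forall>n. \<exists>X r. finite X \<and> X \<subseteq> K \<and> (\<forall>x\<in>X. 0 \<le> r x) \<and> (\<Sum>x\<in>X. r x) \<le> R
     \<and> (\<forall>t. (\<Sum>x\<in>X. g (x - t) * r x) \<le> h t + e n) \<and> V - e n \<le> (\<Sum>x\<in>X. f x * r x)"
    by (intro allI R(2)[rule_format]) (simp add: e_def)
  then obtain X r where X: "\<And>n. finite (X n)" "\<And>n. X n \<subseteq> K"
    and r: "\<And>n x. x \<in> X n \<Longrightarrow> 0 \<le> r n x" "\<And>n. (\<Sum>x\<in>X n. r n x) \<le> R"
    and approx: "\<And>n t. (\<Sum>x\<in>X n. g (x - t) * r n x) \<le> h t + e n"
      "\<And>n. V - e n \<le> (\<Sum>x\<in>X n. f x * r n x)"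
    unfolding choice_iff by blast
  obtain \<rho> s where \<rho>: "sets \<rho> = sets (borel :: 'a measure)" and s: "strict_mono (s :: nat \<Rightarrow> nat)"
    and lim: "\<forall>\<phi> :: 'a \<Rightarrow> real. continuous_on UNIV \<phi> \<longrightarrow> (\<forall>x. 0 \<le> \<phi> x) \<longrightarrow> (\<exists>l. 0 \<le> l \<and>
      (\<integral>\<^sup>+ x. ennreal (\<phi> x) \<partial>\<rho>) = ennreal l \<and> (\<lambda>n. \<Sum>x\<in>X (s n). \<phi> x * r (s n) x) \<longlonglongrightarrow> l)"
    by (rule weakly_convergent_point_masses[OF compact_imp_bounded[OF K(1)] X r])
  have "e \<longlonglongrightarrow> 0" unfolding e_def by (rule LIMSEQ_Suc[OF lim_1_over_n])
  then have e: "(\<lambda>n. e (s n)) \<longlonglongrightarrow> 0"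
    using LIMSEQ_subseq_LIMSEQ[OF _ s] by (simp add: comp_def)
  show ?thesis
  proof (rule that[of \<rho>])
    show "\<rho> \<in> borel_measures" using \<rho> by (simp add: borel_measures_def)
    show "\<forall>t. conv \<rho> (reflect g) t \<le> ennreal (h t)"
    proof
      fix t
      have "continuous_on UNIV (\<lambda>x. g (x - t))"
        by (intro continuous_on_compose2[OF gc] continuous_intros) auto
      then obtain l where l: "(\<integral>\<^sup>+ x. ennreal (g (x - t)) \<partial>\<rho>) = ennreal l"
        "(\<lambda>n. \<Sum>x\<in>X (s n). g (x - t) * r (s n) x) \<longlonglongrightarrow> l"
        using lim[rule_format, of "\<lambda>x. g (x - t)"] g(2) by blast
      have "(\<lambda>n. h t + e (s n)) \<longlonglongrightarrow> h t + 0" by (intro tendsto_add tendsto_const e)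
      then have "l \<le> h t"
        using LIMSEQ_le[OF l(2), of "\<lambda>n. h t + e (s n)" "h t"] approx(1) by auto
      \<comment> \<open>Reflection turns the argument \<open>t - x\<close> into
        \<open>x - t\<close>, so the convolution is the integral just bounded.\<close>
      then show "conv \<rho> (reflect g) t \<le> ennreal (h t)"
        by (simp add: conv_def reflect_def l(1) ennreal_leI)
    qed
    obtain l where l: "(\<integral>\<^sup>+ x. ennreal (f x) \<partial>\<rho>) = ennreal l"
      "(\<lambda>n. \<Sum>x\<in>X (s n). f x * r (s n) x) \<longlonglongrightarrow> l"
      using lim f by blast
    have "(\<lambda>n. V - e (s n)) \<longlonglongrightarrow> V - 0" by (intro tendsto_diff tendsto_const e)
    then have "V \<le> l"
      using LIMSEQ_le[OF _ l(2), of "\<lambda>n. V - e (s n)" V] approx(2) by auto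
    then show "covering_number h f g \<le> (\<integral>\<^sup>+ x. ennreal (f x) \<partial>\<rho>)"
      by (simp add: V l(1) ennreal_leI)
  qed
qed

theorem theorem1p1:
  fixes f g h :: "real ^ 'n \<Rightarrow> real"
  assumes "f \<in> C0" and "g \<in> C0" and "h \<in> C0"
    and "\<forall>x. f x \<ge> 0" and "\<forall>x. g x \<ge> 0" and "\<forall>x. h x \<ge> 0"
    and "\<exists>x. f x \<noteq> 0" and "\<exists>x. g x \<noteq> 0" and "\<exists>x. h x \<noteq> 0"
    and "compactly_supported f"
  shows "separation_number h f (reflect g) = covering_number h f g \<and>
    (\<exists>\<rho> \<in> borel_measures. (\<forall>x. conv \<rho> (reflect g) x \<le> ennreal (h x)) \<and>
       (\<integral>\<^sup>+ x. ennreal (f x) \<partial>\<rho>) = separation_number h f (reflect g))"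
proof -
  have cont: "continuous_on UNIV f" "continuous_on UNIV g" "continuous_on UNIV h"
    using assms(1-3) by (auto simp: C0_def)
  obtain x0 where x0: "0 < g x0" using assms(5,8) by (metis order_less_le)
  define K where "K = closure {x. f x \<noteq> 0}"
  have K: "compact K" "\<And>x. x \<notin> K \<Longrightarrow> f x = 0"
    using assms(10) closure_subset[of "{x. f x \<noteq> 0}"] by (auto simp: K_def compactly_supported_def)
  obtain \<rho> where \<rho>: "\<rho> \<in> borel_measures" "\<forall>x. conv \<rho> (reflect g) x \<le> ennreal (h x)"
    "covering_number h f g \<le> (\<integral>\<^sup>+ x. ennreal (f x) \<partial>\<rho>)"
    by (rule optimal_separation[OF cont(1) assms(4)[rule_format] assms(2) assms(5)[rule_format] x0
          cont(3) assms(6)[rule_format] K])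
  have "(\<integral>\<^sup>+ x. ennreal (f x) \<partial>\<rho>) \<le> separation_number h f (reflect g)"
    unfolding separation_number_def using \<rho>(1,2) by (intro Sup_upper) blast
  moreover have "separation_number h f (reflect g) \<le> covering_number h f g"
    unfolding separation_number_def covering_number_def
    using weak_duality[OF cont(2,3) assms(5)[rule_format] x0 assms(6)[rule_format]]
    by (intro Sup_least Inf_greatest) blast
  \<comment> \<open>The integral of \<open>f\<close> closes the chain: covering number, integral,
    separation number, covering number, each at most the next.\<close>
  ultimately show ?thesis using \<rho> by (intro conjI bexI[of _ \<rho>]) auto
qed

end
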